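(* Let $n\ge 1$, let $\mathbf{A},\mathbf{B},\mathbf{C}\in \mathrm{M}(n,\mathbb{H})$ be given, and consider the two-sided matrix equation $\mathbf{A}\mathbf{X}\mathbf{B}=\mathbf{C}$ with unknown $\mathbf{X}=(x_{ij})\in \mathrm{M}(n,\mathbb{H})$. If $\mathrm{ddet}\,\mathbf{A}\neq 0$ and $\mathrm{ddet}\,\mathbf{B}\neq 0$, then this equation has a unique solution, and the solution is given, for all $i,j=1,\ldots,n$, by $$x_{ij}=\frac{\mathrm{rdet}_{j}\,(\mathbf{B}\mathbf{B}^{*})_{j.}\left(\mathbf{c}_{i.}^{\mathbf{A}}\right)}{\mathrm{ddet}\,\mathbf{A}\cdot\mathrm{ddet}\,\mathbf{B}},$$ or, equally, by $$x_{ij}=\frac{\mathrm{cdet}_{i}\,(\mathbf{A}^{*}\mathbf{A})_{.i}\left(\mathbf{c}_{.j}^{\mathbf{B}}\right)}{\mathrm{ddet}\,\mathbf{A}\cdot\mathrm{ddet}\,\mathbf{B}},$$ where $\tilde{\mathbf{C}}:=\mathbf{A}^{*}\mathbf{C}\mathbf{B}^{*}$ has $i$th row $\tilde{\mathbf{c}}_{i.}$ and $j$th column $\tilde{\mathbf{c}}_{.j}$, $$\mathbf{c}_{i.}^{\mathbf{A}}:=\left(\mathrm{cdet}_{i}(\mathbf{A}^{*}\mathbf{A})_{.i}(\tilde{\mathbf{c}}_{.1}),\ldots,\mathrm{cdet}_{i}(\mathbf{A}^{*}\mathbf{A})_{.i}(\tilde{\mathbf{c}}_{.n})\right)$$ is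 a row vector, and $$\mathbf{c}_{.j}^{\mathbf{B}}:=\left(\mathrm{rdet}_{j}(\mathbf{B}\mathbf{B}^{*})_{j.}(\tilde{\mathbf{c}}_{1.}),\ldots,\mathrm{rdet}_{j}(\mathbf{B}\mathbf{B}^{*})_{j.}(\tilde{\mathbf{c}}_{n.})\right)^{T}$$ is a column vector.
   Context: $\mathbb{H}$ is the (real) quaternion skew field and $\mathrm{M}(n,\mathbb{H})$ the ring of $n\times n$ quaternion matrices. For $\mathbf{A}=(a_{ij})$, $\mathbf{A}^{*}$ is the Hermitian adjoint (conjugate transpose); $\mathbf{A}$ is Hermitian if $\mathbf{A}^*=\mathbf{A}$. For a square matrix $\mathbf{M}$, $\mathbf{M}_{.i}(\mathbf{b})$ denotes the matrix obtained from $\mathbf{M}$ by replacing its $i$th column with the column $\mathbf{b}$, and $\mathbf{M}_{j.}(\mathbf{b})$ denotes the matrix obtained from $\mathbf{M}$ by replacing its $j$th row with the row $\mathbf{b}$. Row determinants. For $\mathbf{A}=(a_{ij})\in \mathrm{M}(n,\mathbb{H})$ and $i\in\{1,\ldots,n\}$, $$\mathrm{rdet}_i\,\mathbf{A}=\sum_{\sigma\in S_n}(-1)^{n-r}\,\bigl(a_{i\,i_{k_1}}a_{i_{k_1}i_{k_1+1}}\cdots a_{i_{k_1+l_1}i}\bigr)\cdots\bigl(a_{i_{k_r}i_{k_r+1}}\cdots a_{i_{k_r+l_r}i_{k_r}}\bigr),$$ where each $\sigma\in S_n$ is written as a product of its $r$ disjoint cycles (fixed points counted as cycles of length one, contributing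 a diagonal entry) in the left-ordered form $$\sigma=(i\,i_{k_1}i_{k_1+1}\ldots i_{k_1+l_1})(i_{k_2}i_{k_2+1}\ldots i_{k_2+l_2})\cdots(i_{k_r}i_{k_r+1}\ldots i_{k_r+l_r}),$$ in which $i$ opens the first cycle from the left, and $i_{k_2}<i_{k_3}<\cdots<i_{k_r}$ and $i_{k_t}<i_{k_t+s}$ for $t=2,\ldots,r$, $s=1,\ldots,l_t$. The order of the factors in each product is exactly as written. Column determinants. For $j\in\{1,\ldots,n\}$, $$\mathrm{cdet}_j\,\mathbf{A}=\sum_{\tau\in S_n}(-1)^{n-r}\,\bigl(a_{j_{k_r}j_{k_r+l_r}}\cdots a_{j_{k_r+1}j_{k_r}}\bigr)\cdots\bigl(a_{j\,j_{k_1+l_1}}\cdots a_{j_{k_1+1}j_{k_1}}a_{j_{k_1}j}\bigr),$$ where each $\tau\in S_n$ is written as a product of its $r$ disjoint cycles (fixed points included) in the right-ordered form $$\tau=(j_{k_r+l_r}\ldots j_{k_r+1}j_{k_r})\cdots(j_{k_2+l_2}\ldots j_{k_2+1}j_{k_2})(j_{k_1+l_1}\ldots j_{k_1+1}j_{k_1}j),$$ in which $j$ opens the first cycle from the right, and $j_{k_2}<j_{k_3}<\cdots<j_{k_r}$ and $j_{k_t}<j_{k_t+s}$ for $t=2,\ldots,r$, $s=1,\ldots,l_t$. Double determinant. It is known that for a Hermitian matrix $\mathbf{M}\in\mathrm{M}(n,\mathbb{H})$ all the values $\mathrm{rdet}_1\mathbf{M},\ldots,\mathrm{rdet}_n\mathbf{M},\mathrm{cdet}_1\mathbf{M},\ldots,\mathrm{cdet}_n\mathbf{M}$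 coincide and are real; this common value is $\det\mathbf{M}$. It is also known that $\det(\mathbf{A}^*\mathbf{A})=\det(\mathbf{A}\mathbf{A}^* )$ for $\mathbf{A}\in \mathrm{M}(n,\mathbb{H})$; the double determinant is $\mathrm{ddet}\,\mathbf{A}:=\det(\mathbf{A}^{*}\mathbf{A})=\det(\mathbf{A}\mathbf{A}^{*})\in\mathbb{R}$. *)

theory Defs
  imports
    Complex_Main
    "HOL-Combinatorics.Cycles"
    "Jordan_Normal_Form.Determinant"
begin

datatype quat = Quat (qre: real) (qi: real) (qj: real) (qk: real)

lemma quat_eq_iff:
  "x = y \<longleftrightarrow> qre x = qre y \<and> qi x = qi y \<and> qj x = qj y \<and> qk x = qk y"
  by (cases x; cases y) simp

definition qcnj :: "quat \<Rightarrow> quat" where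
  "qcnj x = Quat (qre x) (- qi x) (- qj x) (- qk x)"

definition qnorm2 :: "quat \<Rightarrow> real" where
  "qnorm2 x = (qre x)\<^sup>2 + (qi x)\<^sup>2 + (qj x)\<^sup>2 + (qk x)\<^sup>2"

lemma qcnj_sel [simp]:
  "qre (qcnj x) = qre x" "qi (qcnj x) = - qi x" "qj (qcnj x) = - qj x" "qk (qcnj x) = - qk x"
  by (simp_all add: qcnj_def)

lemma qnorm2_eq_0_iff: "qnorm2 x = 0 \<longleftrightarrow> qre x = 0 \<and> qi x = 0 \<and> qj x = 0 \<and> qk x = 0"
  by (simp add: qnorm2_def add_nonneg_eq_0_iff conj_assoc)

instantiation quat :: real_vector
begin

definition "0 = Quat 0 0 0 0"
definition "x + y = Quat (qre x + qre y) (qi x + qi y) (qj x + qj y) (qk x + qk y)"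
definition "- x = Quat (- qre x) (- qi x) (- qj x) (- qk x)"
definition "x - y = Quat (qre x - qre y) (qi x - qi y) (qj x - qj y) (qk x - qk y)"
definition "r *\<^sub>R x = Quat (r * qre x) (r * qi x) (r * qj x) (r * qk x)"

instance
  by standard
    (simp_all add: quat_eq_iff zero_quat_def plus_quat_def uminus_quat_def minus_quat_def
      scaleR_quat_def algebra_simps)

end

instantiation quat :: "{real_algebra_1, division_ring}"
begin

definition "1 = Quat 1 0 0 0"
definition "x * y = Quat
  (qre x * qre y - qi x * qi y - qj x * qj y - qk x * qk y)
  (qre x * qi y + qi x * qre y + qj x * qk y - qk x * qj y)
  (qre x * qj y - qi x * qk y + qj x * qre y + qk x * qi y)
  (qre x * qk y + qi x * qj y - qj x * qi y + qk x * qre y)"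
definition "inverse x = inverse (qnorm2 x) *\<^sub>R qcnj x"
definition "x div y = x * inverse (y::quat)"

instance
proof
  fix x y z :: quat and r :: real
  show "x * y * z = x * (y * z)"
    by (simp add: quat_eq_iff times_quat_def algebra_simps)
  show "1 * x = x" "x * 1 = x"
    by (simp_all add: quat_eq_iff times_quat_def one_quat_def)
  show "(x + y) * z = x * z + y * z" "x * (y + z) = x * y + x * z"
    by (simp_all add: quat_eq_iff times_quat_def plus_quat_def algebra_simps)
  show "r *\<^sub>R x * y = r *\<^sub>R (x * y)" "x * r *\<^sub>R y = r *\<^sub>R (x * y)"
    by (simp_all add: quat_eq_iff times_quat_def scaleR_quat_def algebra_simps)
  show "(0::quat) \<noteq> 1"
    by (simp add: zero_quat_def one_quat_def)
  show "inverse (0::quat) = 0"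
    by (simp add: quat_eq_iff inverse_quat_def zero_quat_def scaleR_quat_def)
  show "x div y = x * inverse y"
    by (rule divide_quat_def)
  show "inverse x * x = 1" "x * inverse x = 1" if "x \<noteq> 0"
  proof -
    have "qnorm2 x \<noteq> 0"
      using that by (simp add: qnorm2_eq_0_iff quat_eq_iff zero_quat_def)
    moreover have "inverse (qnorm2 x) * qnorm2 x = 1"
      using calculation by simp
    ultimately show "inverse x * x = 1" "x * inverse x = 1"
      by (simp_all add: quat_eq_iff inverse_quat_def times_quat_def one_quat_def scaleR_quat_def
        qnorm2_def power2_eq_square algebra_simps)
  qed
qed

end

definition qadj :: "quat mat \<Rightarrow> quat mat" where
  "qadj A = map_mat qcnj (transpose_mat A)"

definition replace_row :: "'a mat \<Rightarrow> 'a vec \<Rightarrow> nat \<Rightarrow> 'a mat" where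
  "replace_row A b k = mat (dim_row A) (dim_col A) (\<lambda>(i, j). if i = k then b $ j else A $$ (i, j))"

text \<open>Indices run over \<open>{0..<n}\<close> instead of \<open>{1..n}\<close>. The list \<open>cycle_heads n i \<sigma>\<close> contains, for each
  cycle of \<open>\<sigma>\<close> on \<open>{0..<n}\<close> (fixed points included), the element that opens it: first \<open>i\<close>, then, in
  increasing order, the least elements of the cycles not containing \<open>i\<close>. Its length is the
  number of cycles.\<close>

definition cycle_heads :: "nat \<Rightarrow> nat \<Rightarrow> (nat \<Rightarrow> nat) \<Rightarrow> nat list" where
  "cycle_heads n i \<sigma> =
     i # filter (\<lambda>s. i \<notin> set (support \<sigma> s) \<and> (\<forall>t \<in> set (support \<sigma> s). s \<le> t)) [0..<n]"

text \<open>For the cycle \<open>s, \<sigma> s, \<dots>, \<sigma>\<^sup>l s\<close> this is the ordered product of the entries at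
  \<open>(s, \<sigma> s), (\<sigma> s, \<sigma>\<^sup>2 s), \<dots>, (\<sigma>\<^sup>l s, s)\<close>. It serves for both determinants: in the right-ordered form
  the cycle opened by \<open>s\<close> is written \<open>(\<sigma> s \<dots> \<sigma>\<^sup>l s s)\<close>, and its product also begins with
  the entry at \<open>(s, \<sigma> s)\<close> and ends with the entry at \<open>(\<sigma>\<^sup>l s, s)\<close>. Only the order of the cycles is reversed.\<close>

definition cycle_prod :: "quat mat \<Rightarrow> (nat \<Rightarrow> nat) \<Rightarrow> nat \<Rightarrow> quat" where
  "cycle_prod A \<sigma> s = prod_list (map (\<lambda>t. A $$ (t, \<sigma> t)) (support \<sigma> s))"

definition rdet :: "nat \<Rightarrow> quat mat \<Rightarrow> quat" where
  "rdet i A = (let n = dim_row A in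
     \<Sum>\<sigma> | \<sigma> permutes {0..<n}. (- 1) ^ (n - length (cycle_heads n i \<sigma>)) *
       prod_list (map (cycle_prod A \<sigma>) (cycle_heads n i \<sigma>)))"

definition cdet :: "nat \<Rightarrow> quat mat \<Rightarrow> quat" where
  "cdet j A = (let n = dim_row A in
     \<Sum>\<tau> | \<tau> permutes {0..<n}. (- 1) ^ (n - length (cycle_heads n j \<tau>)) *
       prod_list (map (cycle_prod A \<tau>) (rev (cycle_heads n j \<tau>))))"

text \<open>The common real value of all row and column determinants; meaningful for Hermitian
  matrices of positive size.\<close>

definition hdet :: "quat mat \<Rightarrow> real" where
  "hdet M = (THE d. \<forall>i < dim_row M. rdet i M = of_real d \<and> cdet i M = of_real d)"

definition ddet :: "quat mat \<Rightarrow> real" where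
  "ddet A = hdet (qadj A * A)"

definition ctilde :: "quat mat \<Rightarrow> quat mat \<Rightarrow> quat mat \<Rightarrow> quat mat" where
  "ctilde A B C = qadj A * C * qadj B"

definition cA_row :: "quat mat \<Rightarrow> quat mat \<Rightarrow> quat mat \<Rightarrow> nat \<Rightarrow> quat vec" where
  "cA_row A B C i =
     vec (dim_col C) (\<lambda>k. cdet i (replace_col (qadj A * A) (col (ctilde A B C) k) i))"

definition cB_col :: "quat mat \<Rightarrow> quat mat \<Rightarrow> quat mat \<Rightarrow> nat \<Rightarrow> quat vec" where
  "cB_col A B C j =
     vec (dim_row C) (\<lambda>k. rdet j (replace_row (B * qadj B) (row (ctilde A B C) k) j))"

end

theory Submission
  imports Defs
begin

text \<open>
  Reversing a cycle of a Hermitian matrix conjugates its cycle product, so in a row or column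
  determinant every cycle product may be replaced by its real part, and the real part does not
  depend on where the cycle is opened. Hence all these determinants agree with one real number,
  the Moore determinant, which can be expanded along the cycle through any chosen index.

  In the column determinant at \<open>i\<close> with column \<open>i\<close> replaced by column \<open>k \<noteq> i\<close>, the cycle through
  \<open>i\<close> becomes a walk from \<open>i\<close> that ends in \<open>k\<close>. If the walk passes through \<open>k\<close> before, it is a simple
  path to \<open>k\<close> followed by a cycle at \<open>k\<close>; otherwise the complementary minor is expanded along the
  cycle through \<open>k\<close>. The two kinds of terms cancel, so the coefficients of the replaced column
  form a left inverse of the matrix up to the factor \<open>det\<close>: this is Cramer's rule.

  The same cancellation on all principal submatrices is a Faddeev--LeVerrier recursion, so the
  sums of principal minors satisfy Newton's identities in the real traces of powers. Real traces
  are cyclic, so \<open>AA\<^sup>*\<close> and \<open>A\<^sup>*A\<close> have the same determinant.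
\<close>

section \<open>Quaternions\<close>

lemma qre_simps [simp]:
  "qre 0 = 0" "qre (x + y) = qre x + qre y" "qre (- x) = - qre x" "qre (x - y) = qre x - qre y"
  "qre (r *\<^sub>R x) = r * qre x"
  "qre (of_real r) = r"
  by (simp_all add: zero_quat_def plus_quat_def uminus_quat_def minus_quat_def
      scaleR_quat_def of_real_def one_quat_def)

lemma qre_sum: "qre (sum f S) = (\<Sum>x\<in>S. qre (f x))"
  by (induction S rule: infinite_finite_induct) simp_all

lemma qre_mult_commute: "qre (x * y) = qre (y * x)"
  by (simp add: times_quat_def algebra_simps)

lemma qcnj_algebra [simp]:
  "qcnj 0 = 0" "qcnj 1 = 1" "qcnj (x + y) = qcnj x + qcnj y" "qcnj (r *\<^sub>R x) = r *\<^sub>R qcnj x"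
  "qcnj (x * y) = qcnj y * qcnj x" "qcnj (qcnj x) = x"
  by (simp_all add: quat_eq_iff zero_quat_def one_quat_def plus_quat_def scaleR_quat_def
      times_quat_def algebra_simps)

lemma qcnj_sum: "qcnj (sum f S) = (\<Sum>x\<in>S. qcnj (f x))"
  by (induction S rule: infinite_finite_induct) simp_all

lemma qcnj_eq_self_imp_real: "qcnj x = x \<Longrightarrow> x = of_real (qre x)"
  by (simp add: quat_eq_iff of_real_def one_quat_def scaleR_quat_def)

section \<open>Sums over lists without repetition\<close>

text \<open>A cycle opened by \<open>i\<close> is encoded as \<open>i # u\<close> with
  \<open>u\<close> such a list; the empty list encodes a fixed point.\<close>

definition distinct_lists :: "'a set \<Rightarrow> 'a list set" where
  "distinct_lists U = {u. distinct u \<and> set u \<subseteq> U}"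

definition distinct_list_pairs :: "'a set \<Rightarrow> ('a list \<times> 'a list) set" where
  "distinct_list_pairs U = {(u, v). distinct (u @ v) \<and> set (u @ v) \<subseteq> U}"

lemma finite_distinct_lists [simp]: "finite U \<Longrightarrow> finite (distinct_lists U)"
  unfolding distinct_lists_def using finite_subset_distinct[of U] by (simp add: conj_commute)

lemma finite_distinct_list_pairs [simp]:
  assumes "finite U" shows "finite (distinct_list_pairs U)"
  by (rule finite_subset[of _ "distinct_lists U \<times> distinct_lists U"])
    (auto simp: assms, auto simp: distinct_list_pairs_def distinct_lists_def)

lemma sum_distinct_lists_nested:
  assumes "finite U"
  shows "(\<Sum>u\<in>distinct_lists U. \<Sum>v\<in>distinct_lists (U - set u). g u v)
       = (\<Sum>(u, v)\<in>distinct_list_pairs U. g u v)"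
proof -
  have "distinct_list_pairs U = (SIGMA u:distinct_lists U. distinct_lists (U - set u))"
    by (auto simp: distinct_list_pairs_def distinct_lists_def)
  thus ?thesis
    using assms by (simp add: sum.Sigma)
qed

lemma sum_distinct_list_pairs_swap:
  "(\<Sum>(u, v)\<in>distinct_list_pairs U. g u v) = (\<Sum>(u, v)\<in>distinct_list_pairs U. g v u)"
  by (rule sum.reindex_bij_witness[of _ prod.swap prod.swap])
    (auto simp: distinct_list_pairs_def)

lemma sum_distinct_lists_rev:
  "(\<Sum>u\<in>distinct_lists U. f u) = (\<Sum>u\<in>distinct_lists U. f (rev u))"
  by (rule sum.reindex_bij_witness[of _ rev rev]) (auto simp: distinct_lists_def)

text \<open>A list either avoids \<open>j\<close> or splits uniquely at its only occurrence of
  \<open>j\<close>.\<close>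

lemma sum_distinct_lists_split:
  assumes "finite U" "j \<in> U"
  shows "(\<Sum>u\<in>distinct_lists U. f u)
       = (\<Sum>u\<in>distinct_lists (U - {j}). f u)
         + (\<Sum>(x, y)\<in>distinct_list_pairs (U - {j}). f (x @ j # y))"
proof -
  let ?J = "(\<lambda>(x, y). x @ j # y) ` distinct_list_pairs (U - {j})"
  have "distinct_lists U = distinct_lists (U - {j}) \<union> ?J"
  proof (intro equalityI subsetI)
    fix u assume u: "u \<in> distinct_lists U"
    show "u \<in> distinct_lists (U - {j}) \<union> ?J"
    proof (cases "j \<in> set u")
      case True
      then obtain x y where xy: "u = x @ j # y" by (auto simp: in_set_conv_decomp)
      hence "(x, y) \<in> distinct_list_pairs (U - {j})"
        using u by (auto simp: distinct_lists_def distinct_list_pairs_def)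
      thus ?thesis using xy by force
    qed (use u in \<open>auto simp: distinct_lists_def\<close>)
  qed (use assms in \<open>auto simp: distinct_lists_def distinct_list_pairs_def\<close>)
  moreover have "distinct_lists (U - {j}) \<inter> ?J = {}"
    by (auto simp: distinct_lists_def)
  moreover have "inj_on (\<lambda>(x, y). x @ j # y) (distinct_list_pairs (U - {j}))"
    by (intro inj_onI) (auto simp: distinct_list_pairs_def append_eq_append_conv2 Cons_eq_append_conv append_eq_Cons_conv)
  ultimately show ?thesis
    using assms by (simp add: sum.union_disjoint sum.reindex case_prod_unfold)
qed

section \<open>The Moore determinant\<close>

fun path_prod :: "('i \<Rightarrow> 'i \<Rightarrow> quat) \<Rightarrow> 'i list \<Rightarrow> quat" where
  "path_prod a (x # y # zs) = a x y * path_prod a (y # zs)"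
| "path_prod a _ = 1"

lemma path_prod_append:
  "path_prod a (u @ k # v) = path_prod a (u @ [k]) * path_prod a (k # v)"
  by (induction a u rule: path_prod.induct) (simp_all add: mult.assoc)

text \<open>Matrices are total functions, so that passing to a principal submatrix only means
  passing to a smaller index set.\<close>

definition hermitian_fun :: "('i \<Rightarrow> 'i \<Rightarrow> quat) \<Rightarrow> bool" where
  "hermitian_fun a \<longleftrightarrow> (\<forall>i j. a j i = qcnj (a i j))"

text \<open>Conjugation reverses the order of a product, and Hermitian symmetry conjugates each
  reversed step.\<close>

lemma path_prod_rev:
  assumes "hermitian_fun a"
  shows "path_prod a (rev u) = qcnj (path_prod a u)"
proof (induction u rule: induct_list012)
  case (3 x y zs)
  have "path_prod a (rev (x # y # zs)) = path_prod a (rev zs @ [y]) * a y x"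
    using path_prod_append[of a "rev zs" y "[x]"] by simp
  moreover have "a y x = qcnj (a x y)"
    using assms unfolding hermitian_fun_def by blast
  ultimately show ?case using 3 by simp
qed simp_all

text \<open>Cutting the closed walk at \<open>i\<close> and \<open>j\<close> leaves two factors,
  which commute under the real part.\<close>

lemma qre_path_prod_rotate:
  "qre (path_prod a (i # x @ j # y @ [i])) = qre (path_prod a (j # y @ i # x @ [j]))"
  using path_prod_append[of a "i # x" j "y @ [i]"] path_prod_append[of a "j # y" i "x @ [j]"]
  by (simp add: qre_mult_commute)

lemma path_prod_cong:
  "(\<And>x y. x \<in> set u \<Longrightarrow> y \<in> set u \<Longrightarrow> a x y = b x y) \<Longrightarrow> path_prod a u = path_prod b u"
  by (induction u rule: induct_list012) simp_all

text \<open>The Moore determinant on the index set \<open>T\<close>, expanded along the cycle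
  through the least index with real parts of cycle products. A cycle of length
  \<open>length u + 1\<close> has sign \<open>(- 1) ^ length u\<close>. The value 1 is the base case
  for the empty set and a mere default for infinite sets.\<close>

function moore_det :: "(nat \<Rightarrow> nat \<Rightarrow> quat) \<Rightarrow> nat set \<Rightarrow> real" where
  "moore_det a T = (if finite T \<and> T \<noteq> {}
     then \<Sum>u\<in>distinct_lists (T - {Min T}). (- 1) ^ length u *
            qre (path_prod a (Min T # u @ [Min T])) * moore_det a (T - {Min T} - set u)
     else 1)"
  by pat_completeness auto
termination
proof (relation "measure (\<lambda>(a, T). card T)")
  fix T :: "nat set" and u
  assume T: "finite T \<and> T \<noteq> {}"
  hence "T - {Min T} - set u \<subset> T" using Min_in[of T] by blast
  thus "((a, T - {Min T} - set u), a, T) \<in> measure (\<lambda>(a, T). card T)" for a :: "nat \<Rightarrow> nat \<Rightarrow> quat"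
    using T by (simp add: psubset_card_mono)
qed simp

declare moore_det.simps [simp del]

lemma moore_det_empty [simp]: "moore_det a {} = 1"
  by (simp add: moore_det.simps)

text \<open>Strong induction on the cardinality: after expanding along \<open>i\<close>, the terms
  whose cycle misses \<open>j\<close> are expanded further along \<open>j\<close>. The result is
  symmetric in \<open>i\<close> and \<open>j\<close>, so the least index can be traded for any
  other.\<close>

lemma moore_det_expand:
  assumes "finite T" "i \<in> T"
  shows "moore_det a T = (\<Sum>u\<in>distinct_lists (T - {i}). (- 1) ^ length u *
           qre (path_prod a (i # u @ [i])) * moore_det a (T - {i} - set u))"
  using assms
proof (induction "card T" arbitrary: T i rule: less_induct)
  case less
  txt \<open>\<open>F\<close> collects pairs of disjoint cycles through \<open>i\<close> and \<open>j\<close>, and \<open>G\<close> single cycles through both;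
    up to exchanging \<open>i\<close> and \<open>j\<close>, both are symmetric.\<close>
  define E where "E = (\<lambda>i. \<Sum>u\<in>distinct_lists (T - {i}). (- 1) ^ length u *
           qre (path_prod a (i # u @ [i])) * moore_det a (T - {i} - set u))"
  define F where "F = (\<lambda>i j u v. (- 1) ^ (length u + length v) * qre (path_prod a (i # u @ [i])) *
           qre (path_prod a (j # v @ [j])) * moore_det a (T - {i, j} - set u - set v))"
  define G where "G = (\<lambda>i j u v. (- 1) ^ (length u + length v + 1) *
           qre (path_prod a (i # u @ j # v @ [i])) * moore_det a (T - {i, j} - set u - set v))"
  have E: "E i = (\<Sum>(u, v)\<in>distinct_list_pairs (T - {i, j}). F i j u v)
             + (\<Sum>(u, v)\<in>distinct_list_pairs (T - {i, j}). G i j u v)"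
    if ij: "i \<in> T" "j \<in> T" "i \<noteq> j" for i j
  proof -
    have Tij: "T - {i} - {j} = T - {i, j}" by auto
    have "(- 1) ^ length u * qre (path_prod a (i # u @ [i])) * moore_det a (T - {i} - set u)
        = (\<Sum>v\<in>distinct_lists (T - {i, j} - set u). F i j u v)"
      if u: "u \<in> distinct_lists (T - {i, j})" for u
    proof -
      let ?T = "T - {i} - set u"
      have j: "j \<in> ?T" using u ij by (auto simp: distinct_lists_def)
      have "?T \<subset> T" using ij by blast
      hence "card ?T < card T" using less.prems by (simp add: psubset_card_mono)
      hence "moore_det a ?T = (\<Sum>v\<in>distinct_lists (?T - {j}). (- 1) ^ length v *
           qre (path_prod a (j # v @ [j])) * moore_det a (?T - {j} - set v))"
        using less.hyps[of ?T j] less.prems j by simp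
      moreover have "?T - {j} = T - {i, j} - set u" by auto
      ultimately show ?thesis
        by (simp add: F_def sum_distrib_left power_add algebra_simps)
    qed
    moreover have "(- 1) ^ length (x @ j # y) * qre (path_prod a (i # (x @ j # y) @ [i])) *
         moore_det a (T - {i} - set (x @ j # y)) = G i j x y" for x y
    proof -
      have "T - {i} - set (x @ j # y) = T - {i, j} - set x - set y" by auto
      thus ?thesis by (simp add: G_def)
    qed
    ultimately show ?thesis
      unfolding E_def using ij less.prems
      by (subst sum_distinct_lists_split[of _ j])
        (simp_all add: Tij sum_distinct_lists_nested[symmetric] cong: sum.cong)
  qed
  have "E i = E j" if ij: "i \<in> T" "j \<in> T" for i j
  proof (cases "i = j")
    case False
    \<comment> \<open>\<open>F\<close> is a product of commuting reals; in \<open>G\<close> the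
      common cycle is reopened at \<open>j\<close>.\<close>
    have "F i j u v = F j i v u" "G i j u v = G j i v u" for u v
    proof -
      have "T - {i, j} - set u - set v = T - {j, i} - set v - set u" by auto
      thus "F i j u v = F j i v u" "G i j u v = G j i v u"
        unfolding F_def G_def qre_path_prod_rotate[of a i u j v] by (simp_all add: add.commute mult_ac)
    qed
    hence FG: "F i j = (\<lambda>u v. F j i v u)" "G i j = (\<lambda>u v. G j i v u)" by blast+
    show ?thesis
      unfolding E[OF ij False] E[OF ij(2,1) False[symmetric]] FG insert_commute[of i j]
      by (subst (1 2) sum_distinct_list_pairs_swap) simp
  qed simp
  moreover have "moore_det a T = E (Min T)"
    using less.prems by (subst moore_det.simps) (auto simp: E_def)
  moreover have "Min T \<in> T" using less.prems by (intro Min_in) auto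
  ultimately have "moore_det a T = E i" using less.prems by metis
  thus ?case unfolding E_def .
qed

text \<open>Reversing \<open>u\<close> conjugates the cycle product and keeps its coefficient. The
  sum is therefore its own conjugate, hence equal to its real part.\<close>

lemma moore_det_expand_hermitian:
  assumes a: "hermitian_fun a" and T: "finite T" "i \<in> T"
  shows "(\<Sum>u\<in>distinct_lists (T - {i}). ((- 1) ^ length u * moore_det a (T - {i} - set u)) *\<^sub>R
           path_prod a (i # u @ [i])) = of_real (moore_det a T)" (is "?S = _")
proof -
  have "qcnj ?S = (\<Sum>u\<in>distinct_lists (T - {i}). ((- 1) ^ length u * moore_det a (T - {i} - set u)) *\<^sub>R
           path_prod a (i # rev u @ [i]))"
  proof -
    have "qcnj (path_prod a (i # u @ [i])) = path_prod a (i # rev u @ [i])" for u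
      using path_prod_rev[OF a, of "i # u @ [i]"] by simp
    thus ?thesis by (simp add: qcnj_sum)
  qed
  also have "\<dots> = ?S"
    by (subst (2) sum_distinct_lists_rev) simp
  finally have "?S = of_real (qre ?S)"
    by (rule qcnj_eq_self_imp_real)
  also have "qre ?S = moore_det a T"
    unfolding moore_det_expand[OF T] by (simp add: qre_sum mult_ac)
  finally show ?thesis .
qed

text \<open>A walk that meets \<open>k\<close> only at its end is completed by the real expansion of
  the complement along \<open>k\<close>, placed on the right. A walk that meets \<open>k\<close>
  earlier has the same product but one more inner vertex, hence the opposite sign.\<close>

lemma moore_det_replaced_column:
  assumes a: "hermitian_fun a" and T: "finite T" "i \<in> T" "k \<in> T" "i \<noteq> k"
  shows "(\<Sum>u\<in>distinct_lists (T - {i}). ((- 1) ^ length u * moore_det a (T - {i} - set u)) *\<^sub>R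
           path_prod a (i # u @ [k])) = 0"
proof -
  define F where "F = (\<lambda>u v. ((- 1) ^ (length u + length v) * moore_det a (T - {i, k} - set u - set v)) *\<^sub>R
      path_prod a (i # u @ k # v @ [k]))"
  have Tik: "T - {i} - {k} = T - {i, k}" by auto
  have "((- 1) ^ length u * moore_det a (T - {i} - set u)) *\<^sub>R path_prod a (i # u @ [k])
      = (\<Sum>v\<in>distinct_lists (T - {i, k} - set u). F u v)"
    if u: "u \<in> distinct_lists (T - {i, k})" for u
  proof -
    let ?T = "T - {i} - set u"
    have "k \<in> ?T" using u T by (auto simp: distinct_lists_def)
    from moore_det_expand_hermitian[OF a _ this]
    have "of_real (moore_det a ?T) = (\<Sum>v\<in>distinct_lists (?T - {k}).
        ((- 1) ^ length v * moore_det a (?T - {k} - set v)) *\<^sub>R path_prod a (k # v @ [k]))"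
      using T by simp
    moreover have "?T - {k} = T - {i, k} - set u" by auto
    moreover have "((- 1) ^ length u * moore_det a ?T) *\<^sub>R path_prod a (i # u @ [k])
        = (- 1) ^ length u *\<^sub>R (path_prod a (i # u @ [k]) * of_real (moore_det a ?T))"
      by (simp add: of_real_def)
    ultimately show ?thesis
      using path_prod_append[of a "i # u" k "_ @ [k]"]
      by (simp add: F_def scaleR_sum_right sum_distrib_left power_add mult_ac)
  qed
  moreover have "((- 1) ^ length (x @ k # y) * moore_det a (T - {i} - set (x @ k # y))) *\<^sub>R
         path_prod a (i # (x @ k # y) @ [k]) = - F x y" for x y
  proof -
    have "T - {i} - set (x @ k # y) = T - {i, k} - set x - set y" by auto
    thus ?thesis by (simp add: F_def)
  qed
  ultimately have "(\<Sum>u\<in>distinct_lists (T - {i}). ((- 1) ^ length u * moore_det a (T - {i} - set u)) *\<^sub>R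
           path_prod a (i # u @ [k]))
      = (\<Sum>u\<in>distinct_lists (T - {i, k}). \<Sum>v\<in>distinct_lists (T - {i, k} - set u). F u v)
        + (\<Sum>(x, y)\<in>distinct_list_pairs (T - {i, k}). - F x y)"
    using T by (subst sum_distinct_lists_split[of _ k]) (simp_all add: Tik cong: sum.cong)
  thus ?thesis
    using T by (simp add: sum_distinct_lists_nested case_prod_unfold sum_negf)
qed

text \<open>The coefficient of the entry in row \<open>m\<close> of the replaced column in \<open>cdet\<^sub>i\<close>.\<close>

definition moore_cof :: "(nat \<Rightarrow> nat \<Rightarrow> quat) \<Rightarrow> nat set \<Rightarrow> nat \<Rightarrow> nat \<Rightarrow> quat" where
  "moore_cof a T i m = (if m = i then of_real (moore_det a (T - {i}))
     else \<Sum>u\<in>distinct_lists (T - {i, m}).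
       ((- 1) ^ (length u + 1) * moore_det a (T - {i, m} - set u)) *\<^sub>R path_prod a (i # u @ [m]))"

lemma sum_distinct_lists_last:
  assumes "finite U"
  shows "(\<Sum>u\<in>distinct_lists U. f u) = f [] + (\<Sum>m\<in>U. \<Sum>u\<in>distinct_lists (U - {m}). f (u @ [m]))"
proof -
  let ?J = "(\<lambda>(m, u). u @ [m]) ` (SIGMA m:U. distinct_lists (U - {m}))"
  have "distinct_lists U = insert [] ?J"
  proof (intro equalityI subsetI)
    fix u assume u: "u \<in> distinct_lists U"
    show "u \<in> insert [] ?J"
    proof (cases u rule: rev_cases)
      case (snoc v m)
      hence "(m, v) \<in> (SIGMA m:U. distinct_lists (U - {m}))"
        using u by (auto simp: distinct_lists_def)
      thus ?thesis using snoc by force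
    qed simp
  qed (auto simp: distinct_lists_def)
  moreover have "[] \<notin> ?J" by auto
  moreover have "inj_on (\<lambda>(m, u). u @ [m]) (SIGMA m:U. distinct_lists (U - {m}))"
    by (auto simp: inj_on_def)
  ultimately show ?thesis
    using assms by (simp add: sum.Sigma sum.reindex case_prod_unfold)
qed

text \<open>Lists are grouped by the last vertex \<open>m\<close> of \<open>i # u\<close>; the empty
  list gives \<open>m = i\<close>. This turns a row of cofactors times a column \<open>b\<close>
  into walks from \<open>i\<close> whose closing step is taken from \<open>b\<close>.\<close>

lemma sum_moore_cof:
  assumes T: "finite T" "i \<in> T"
  shows "(\<Sum>m\<in>T. moore_cof a T i m * b m) = (\<Sum>u\<in>distinct_lists (T - {i}).
      ((- 1) ^ length u * moore_det a (T - {i} - set u)) *\<^sub>R (path_prod a (i # u) * b (last (i # u))))"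
proof -
  have "moore_cof a T i m * b m = (\<Sum>u\<in>distinct_lists (T - {i} - {m}).
      ((- 1) ^ length (u @ [m]) * moore_det a (T - {i} - set (u @ [m]))) *\<^sub>R
        (path_prod a (i # u @ [m]) * b (last (i # u @ [m]))))" if "m \<in> T - {i}" for m
  proof -
    have "T - {i} - {m} = T - {i, m}" "T - {i} - set (u @ [m]) = T - {i, m} - set u" for u by auto
    thus ?thesis using that by (simp add: moore_cof_def sum_distrib_right)
  qed
  hence "(\<Sum>m\<in>T - {i}. moore_cof a T i m * b m) = (\<Sum>m\<in>T - {i}. \<Sum>u\<in>distinct_lists (T - {i} - {m}).
      ((- 1) ^ length (u @ [m]) * moore_det a (T - {i} - set (u @ [m]))) *\<^sub>R
        (path_prod a (i # u @ [m]) * b (last (i # u @ [m]))))"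
    by (rule sum.cong[OF refl])
  moreover have "moore_cof a T i i * b i = moore_det a (T - {i}) *\<^sub>R b i"
    by (simp add: moore_cof_def of_real_def)
  ultimately show ?thesis
    using T by (subst sum.remove[of T i], simp, simp)
      (subst sum_distinct_lists_last, simp_all)
qed

lemma path_prod_snoc: "u \<noteq> [] \<Longrightarrow> path_prod a (u @ [k]) = path_prod a u * a (last u) k"
  by (induction u rule: induct_list012) (simp_all add: mult.assoc)

text \<open>With column \<open>k\<close> of \<open>a\<close> in the role of \<open>b\<close>, all
  walks end in \<open>k\<close>. For \<open>k = i\<close> they are closed and give the expansion;
  otherwise they cancel.\<close>

lemma moore_cof_mult:
  assumes a: "hermitian_fun a" and T: "finite T" "i \<in> T" "k \<in> T"
  shows "(\<Sum>m\<in>T. moore_cof a T i m * a m k) = (if i = k then of_real (moore_det a T) else 0)"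
proof -
  have "(\<Sum>m\<in>T. moore_cof a T i m * a m k) = (\<Sum>u\<in>distinct_lists (T - {i}).
      ((- 1) ^ length u * moore_det a (T - {i} - set u)) *\<^sub>R (path_prod a (i # u @ [k])))"
    using sum_moore_cof[OF T(1,2), of a "\<lambda>m. a m k"] path_prod_snoc[of "i # _" a k] by simp
  thus ?thesis
    using moore_det_expand_hermitian[OF a T(1,2)] moore_det_replaced_column[OF a T] by auto
qed

text \<open>The walks leave \<open>T\<close> in their last step to \<open>k\<close>, and their
  complements are those in the cofactor over \<open>insert k T\<close>. The sign comes from the
  exponent \<open>length u + 1\<close> in \<open>moore_cof\<close>.\<close>

lemma moore_cof_mult_outside:
  assumes T: "finite T" "i \<in> T" "k \<notin> T"
  shows "(\<Sum>m\<in>T. moore_cof a T i m * a m k) = - moore_cof a (insert k T) i k"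
proof -
  have "insert k T - {i, k} = T - {i}" "i \<noteq> k" using T by auto
  thus ?thesis
    using sum_moore_cof[OF T(1,2), of a "\<lambda>m. a m k"] path_prod_snoc[of "i # _" a k]
    by (simp add: moore_cof_def sum_negf)
qed

section \<open>Newton identities and the determinant of a commuted product\<close>

text \<open>The analogue of the elementary symmetric function of degree \<open>k\<close> in the
  eigenvalues.\<close>

definition principal_minors :: "(nat \<Rightarrow> nat \<Rightarrow> quat) \<Rightarrow> nat set \<Rightarrow> nat \<Rightarrow> real" where
  "principal_minors a S k = (\<Sum>T | T \<subseteq> S \<and> card T = k. moore_det a T)"

text \<open>The coefficient of \<open>t\<^bsup>n - 1 - k\<^esup>\<close> in the cofactor matrix of \<open>t + a\<close>, where \<open>n = card S\<close>.\<close>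

definition cof_coeff :: "(nat \<Rightarrow> nat \<Rightarrow> quat) \<Rightarrow> nat set \<Rightarrow> nat \<Rightarrow> nat \<Rightarrow> nat \<Rightarrow> quat" where
  "cof_coeff a S k i j = (\<Sum>T | T \<subseteq> S \<and> card T = Suc k \<and> i \<in> T \<and> j \<in> T. moore_cof a T i j)"

text \<open>\<open>R\<close> holds the index that must be present besides \<open>j\<close>: the row
  index off the diagonal, none on it.\<close>

lemma sum_subsets_containing:
  assumes "finite S" "j \<in> S" "j \<notin> R"
  shows "(\<Sum>T | T \<subseteq> S \<and> card T = Suc k \<and> R \<subseteq> T \<and> j \<in> T. f T)
       = (\<Sum>T | T \<subseteq> S \<and> card T = k \<and> R \<subseteq> T \<and> j \<notin> T. f (insert j T))"
proof (rule sum.reindex_bij_witness[of _ "insert j" "\<lambda>T. T - {j}"], goal_cases)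
  case (2 T)
  thus ?case using assms by (auto simp: card_Diff_singleton finite_subset)
next
  case (4 T)
  hence "finite T" using assms finite_subset by blast
  thus ?case using 4 assms by auto
qed (use assms in \<open>auto simp: insert_absorb\<close>)

text \<open>One step of the Faddeev--LeVerrier recursion. Subsets containing \<open>j\<close>
  contribute by Cramer's rule, only on the diagonal; the others are enlarged by \<open>j\<close> and
  give the cofactors of the next size.\<close>

lemma cof_coeff_mult:
  assumes a: "hermitian_fun a" and S: "finite S" "i \<in> S" "j \<in> S"
  shows "(\<Sum>m\<in>S. cof_coeff a S k i m * a m j)
       = (if i = j then of_real (principal_minors a S (Suc k)) else 0) - cof_coeff a S (Suc k) i j"
proof -
  let ?C = "\<lambda>P. {T. T \<subseteq> S \<and> card T = Suc k \<and> P T}"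
  have fin: "finite (?C P)" for P using S by simp
  have "(\<Sum>m\<in>S. cof_coeff a S k i m * a m j)
      = (\<Sum>m\<in>S. \<Sum>T\<in>?C (\<lambda>T. i \<in> T). if m \<in> T then moore_cof a T i m * a m j else 0)"
    unfolding cof_coeff_def sum_distrib_right
    by (intro sum.cong refl sum.mono_neutral_cong_left fin) auto
  also have "\<dots> = (\<Sum>T\<in>?C (\<lambda>T. i \<in> T). \<Sum>m\<in>S. if m \<in> T then moore_cof a T i m * a m j else 0)"
    by (rule sum.swap)
  also have "\<dots> = (\<Sum>T\<in>?C (\<lambda>T. i \<in> T). \<Sum>m\<in>T. moore_cof a T i m * a m j)"
    using S by (intro sum.cong refl sum.mono_neutral_cong_right) auto
  also have "\<dots> = (\<Sum>T\<in>?C (\<lambda>T. i \<in> T). if j \<in> T then (if i = j then of_real (moore_det a T) else 0)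
      else - moore_cof a (insert j T) i j)"
  proof (intro sum.cong refl)
    fix T assume "T \<in> ?C (\<lambda>T. i \<in> T)"
    moreover from this have "finite T" using S finite_subset by blast
    ultimately show "(\<Sum>m\<in>T. moore_cof a T i m * a m j) =
        (if j \<in> T then (if i = j then of_real (moore_det a T) else 0) else - moore_cof a (insert j T) i j)"
      using moore_cof_mult[OF a, of T i j] moore_cof_mult_outside[of T i j a] by auto
  qed
  also have "\<dots> = (if i = j then of_real (principal_minors a S (Suc k)) else 0) - cof_coeff a S (Suc k) i j"
  proof (cases "i = j")
    case True
    \<comment> \<open>The minors missing from the sum over sets containing \<open>i\<close> are
      those that avoid \<open>i\<close>; they form the diagonal coefficient at
      \<open>Suc k\<close>.\<close>
    have "principal_minors a S (Suc k)
        = (\<Sum>T\<in>?C (\<lambda>T. i \<in> T). moore_det a T) + (\<Sum>T\<in>?C (\<lambda>T. i \<notin> T). moore_det a T)"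
      unfolding principal_minors_def using fin
      by (subst sum.union_disjoint[symmetric]) (auto intro: sum.cong)
    moreover have "(\<Sum>T\<in>?C (\<lambda>T. i \<notin> T). moore_det a (insert i T - {i})) = (\<Sum>T\<in>?C (\<lambda>T. i \<notin> T). moore_det a T)"
      by (rule sum.cong) auto
    ultimately show ?thesis
      using True sum_subsets_containing[OF S(1,2), of "{}" "\<lambda>T. moore_cof a T i i" "Suc k"]
      by (simp add: cof_coeff_def moore_cof_def flip: of_real_sum)
  next
    case False
    have "(\<Sum>T\<in>?C (\<lambda>T. i \<in> T). if j \<in> T then (if i = j then of_real (moore_det a T) else 0)
        else - moore_cof a (insert j T) i j) = (\<Sum>T\<in>?C (\<lambda>T. i \<in> T \<and> j \<notin> T). - moore_cof a (insert j T) i j)"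
      using False fin by (intro sum.mono_neutral_cong_right) auto
    thus ?thesis
      using False sum_subsets_containing[OF S(1,3), of "{i}" "\<lambda>T. moore_cof a T i j" "Suc k"]
      by (simp add: cof_coeff_def sum_negf)
  qed
  finally show ?thesis .
qed

section \<open>Real traces of powers of a product\<close>

definition fmul :: "'i set \<Rightarrow> ('i \<Rightarrow> 'i \<Rightarrow> quat) \<Rightarrow> ('i \<Rightarrow> 'i \<Rightarrow> quat) \<Rightarrow> 'i \<Rightarrow> 'i \<Rightarrow> quat" where
  "fmul S x y i j = (\<Sum>m\<in>S. x i m * y m j)"

lemma fmul_assoc: "fmul S (fmul S x y) z = fmul S x (fmul S y z)"
  unfolding fmul_def fun_eq_iff sum_distrib_left sum_distrib_right mult.assoc
  by (auto intro: sum.swap)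

text \<open>Over the quaternions it is the real part of the trace that is cyclic, not the trace
  itself.\<close>

lemma qre_trace_commute: "(\<Sum>i\<in>S. qre (fmul S x y i i)) = (\<Sum>i\<in>S. qre (fmul S y x i i))"
  unfolding fmul_def qre_sum by (subst sum.swap) (simp add: qre_mult_commute)

text \<open>The exponent is shifted: \<open>fpow S a l\<close> is the power \<open>a\<^bsup>l + 1\<^esup>\<close>.\<close>

fun fpow :: "'i set \<Rightarrow> ('i \<Rightarrow> 'i \<Rightarrow> quat) \<Rightarrow> nat \<Rightarrow> 'i \<Rightarrow> 'i \<Rightarrow> quat" where
  "fpow S a 0 = a"
| "fpow S a (Suc l) = fmul S (fpow S a l) a"

lemma fpow_mult_commute: "fmul S (fpow S (fmul S x y) l) x = fmul S x (fpow S (fmul S y x) l)"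
proof (induction l)
  case (Suc l)
  have "fmul S (fpow S (fmul S x y) (Suc l)) x = fmul S (fmul S (fpow S (fmul S x y) l) x) (fmul S y x)"
    by (simp add: fmul_assoc)
  thus ?case by (simp add: Suc.IH fmul_assoc)
qed (simp add: fmul_assoc)

text \<open>For positive \<open>l\<close> the power of \<open>xy\<close> has the form
  \<open>x p y\<close> and that of \<open>yx\<close> the form \<open>p y x\<close>, with
  \<open>p\<close> a power of \<open>yx\<close>; rotating \<open>x\<close> matches the
  traces.\<close>

lemma qre_trace_fpow_commute:
  "(\<Sum>i\<in>S. qre (fpow S (fmul S x y) l i i)) = (\<Sum>i\<in>S. qre (fpow S (fmul S y x) l i i))"
proof (cases l)
  case 0
  thus ?thesis by (simp add: qre_trace_commute)
next
  case (Suc k)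
  have "fpow S (fmul S x y) l = fmul S (fmul S (fpow S (fmul S x y) k) x) y"
    by (simp add: Suc fmul_assoc)
  hence "fpow S (fmul S x y) l = fmul S x (fmul S (fpow S (fmul S y x) k) y)"
    by (simp add: fpow_mult_commute fmul_assoc)
  moreover have "fpow S (fmul S y x) l = fmul S (fmul S (fpow S (fmul S y x) k) y) x"
    by (simp add: Suc fmul_assoc)
  ultimately show ?thesis
    using qre_trace_commute by metis
qed

text \<open>Unrolling \<open>cof_coeff_mult\<close> gives a polynomial in \<open>a\<close> with
  alternating signs. Its constant term stands apart because \<open>fpow\<close> starts with the
  first power.\<close>

lemma cof_coeff_eq:
  assumes a: "hermitian_fun a" and S: "finite S" "i \<in> S" "j \<in> S"
  shows "cof_coeff a S k i j = (if i = j then of_real (principal_minors a S k) else 0)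
       + (\<Sum>l<k. ((- 1) ^ Suc l * principal_minors a S (k - Suc l)) *\<^sub>R fpow S a l i j)"
  using S(3)
proof (induction k arbitrary: j)
  case 0
  have "{T. T \<subseteq> S \<and> card T = Suc 0 \<and> i \<in> T \<and> j \<in> T} = (if i = j then {{i}} else {})"
    using S by (auto simp: card_Suc_eq)
  moreover have "{T. T \<subseteq> S \<and> card T = 0} = {{}}"
    using S finite_subset by fastforce
  ultimately show ?case
    by (simp add: cof_coeff_def principal_minors_def moore_cof_def)
next
  case (Suc k)
  let ?e = "principal_minors a S"
  have "(\<Sum>m\<in>S. cof_coeff a S k i m * a m j)
      = (\<Sum>m\<in>S. (if i = m then of_real (?e k) * a i j else 0)
          + (\<Sum>l<k. ((- 1) ^ Suc l * ?e (k - Suc l)) *\<^sub>R (fpow S a l i m * a m j)))"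
    by (intro sum.cong refl) (simp add: Suc.IH distrib_right sum_distrib_right)
  also have "\<dots> = of_real (?e k) * a i j
      + (\<Sum>l<k. ((- 1) ^ Suc l * ?e (k - Suc l)) *\<^sub>R fpow S a (Suc l) i j)"
    using S by (simp add: sum.distrib fmul_def scaleR_sum_right sum.swap[of _ S])
  finally show ?case
    using cof_coeff_mult[OF a S(1,2) Suc.prems, of k]
    by (subst sum.lessThan_Suc_shift) (simp add: sum_negf algebra_simps of_real_def)
qed

text \<open>The diagonal coefficient at \<open>i\<close> sums the minors of size \<open>k\<close>
  that avoid \<open>i\<close>, and each set of size \<open>k\<close> is avoided by
  \<open>card S - k\<close> indices.\<close>

lemma trace_cof_coeff:
  assumes S: "finite S"
  shows "(\<Sum>i\<in>S. qre (cof_coeff a S k i i)) = (real (card S) - real k) * principal_minors a S k"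
proof -
  have "qre (cof_coeff a S k i i) = (\<Sum>T | T \<subseteq> S \<and> card T = k. if i \<notin> T then moore_det a T else 0)"
    if "i \<in> S" for i
  proof -
    have "qre (cof_coeff a S k i i)
        = (\<Sum>T | T \<subseteq> S \<and> card T = k \<and> i \<notin> T. qre (moore_cof a (insert i T) i i))"
      using sum_subsets_containing[OF S that, of "{}" "\<lambda>T. moore_cof a T i i" k]
      by (simp add: cof_coeff_def qre_sum)
    also have "\<dots> = (\<Sum>T | T \<subseteq> S \<and> card T = k. if i \<notin> T then moore_det a T else 0)"
      using S by (intro sum.mono_neutral_cong_left) (auto simp: moore_cof_def)
    finally show ?thesis .
  qed
  hence "(\<Sum>i\<in>S. qre (cof_coeff a S k i i))
      = (\<Sum>T | T \<subseteq> S \<and> card T = k. \<Sum>i\<in>S. if i \<notin> T then moore_det a T else 0)"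
    by (simp add: sum.swap[of _ S])
  also have "\<dots> = (\<Sum>T | T \<subseteq> S \<and> card T = k. (real (card S) - real k) * moore_det a T)"
  proof (intro sum.cong refl)
    fix T assume T: "T \<in> {T. T \<subseteq> S \<and> card T = k}"
    have "(\<Sum>i\<in>S. if i \<notin> T then moore_det a T else 0) = (\<Sum>i\<in>S - T. moore_det a T)"
      using S by (intro sum.mono_neutral_cong_right) auto
    also have "\<dots> = (real (card S) - real k) * moore_det a T"
      using T S by (auto simp: card_Diff_subset finite_subset of_nat_diff card_mono)
    finally show "(\<Sum>i\<in>S. if i \<notin> T then moore_det a T else 0) = (real (card S) - real k) * moore_det a T" .
  qed
  finally show ?thesis by (simp add: principal_minors_def sum_distrib_left)
qed

text \<open>Real traces are taken in \<open>cof_coeff_eq\<close> and compared with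
  \<open>trace_cof_coeff\<close>; the multiples of \<open>card S\<close> cancel.\<close>

lemma principal_minors_newton:
  assumes a: "hermitian_fun a" and S: "finite S"
  shows "real k * principal_minors a S k
    = (\<Sum>l<k. (- 1) ^ l * principal_minors a S (k - Suc l) * (\<Sum>i\<in>S. qre (fpow S a l i i)))"
proof -
  let ?e = "principal_minors a S"
  have "(real (card S) - real k) * ?e k = (\<Sum>i\<in>S. qre (cof_coeff a S k i i))"
    by (rule trace_cof_coeff[OF S, symmetric])
  also have "\<dots> = (\<Sum>i\<in>S. ?e k + (\<Sum>l<k. (- 1) ^ Suc l * ?e (k - Suc l) * qre (fpow S a l i i)))"
    using S by (intro sum.cong refl) (simp add: cof_coeff_eq[OF a] qre_sum sum_negf)
  also have "\<dots> = real (card S) * ?e k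
      - (\<Sum>l<k. (- 1) ^ l * ?e (k - Suc l) * (\<Sum>i\<in>S. qre (fpow S a l i i)))"
    by (simp add: sum.distrib sum_negf sum_distrib_left sum_subtractf sum.swap[of _ S])
  finally show ?thesis by (simp add: algebra_simps)
qed

text \<open>Newton's identities determine each sum of principal minors from the smaller ones and the
  real traces of powers, since \<open>real k\<close> can be cancelled for positive \<open>k\<close>.
  The minor of size \<open>card S\<close> is the determinant itself.\<close>

lemma moore_det_fmul_commute:
  assumes S: "finite S" and xy: "hermitian_fun (fmul S x y)" and yx: "hermitian_fun (fmul S y x)"
  shows "moore_det (fmul S x y) S = moore_det (fmul S y x) S"
proof -
  have "principal_minors (fmul S x y) S k = principal_minors (fmul S y x) S k" for k
  proof (induction k rule: less_induct)
    case (less k)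
    show ?case
    proof (cases "k = 0")
      case True
      have "{T. T \<subseteq> S \<and> card T = 0} = {{}}"
        using S finite_subset by fastforce
      thus ?thesis using True by (simp add: principal_minors_def)
    next
      case False
      have "real k * principal_minors (fmul S x y) S k = real k * principal_minors (fmul S y x) S k"
        unfolding principal_minors_newton[OF xy S] principal_minors_newton[OF yx S]
        by (intro sum.cong refl) (simp add: less.IH qre_trace_fpow_commute)
      thus ?thesis using False by simp
    qed
  qed
  moreover have "{T. T \<subseteq> S \<and> card T = card S} = {S}"
    using S card_subset_eq by blast
  hence "principal_minors a S (card S) = moore_det a S" for a
    by (simp add: principal_minors_def)
  ultimately show ?thesis by metis
qed

section \<open>Splitting off a cycle of a permutation\<close>

text \<open>As real scalars, signs move freely past noncommuting factors.\<close>

lemma minus_one_power_mult: "(- 1) ^ k * x = (- 1) ^ k *\<^sub>R x" for x :: quat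
  by (cases "even k") auto

lemma permutation_if_permutes: "finite T \<Longrightarrow> \<sigma> permutes T \<Longrightarrow> permutation \<sigma>"
  by (auto simp: permutation_permutes)

lemma self_in_support: "permutation \<sigma> \<Longrightarrow> s \<in> set (support \<sigma> s)"
  using least_power_of_permutation(2)[of \<sigma> s] by (force simp: image_iff)

lemma in_support_commute: "permutation \<sigma> \<Longrightarrow> s \<in> set (support \<sigma> i) \<longleftrightarrow> i \<in> set (support \<sigma> s)"
  using disjoint_support'[of \<sigma> s i] disjoint_support'[of \<sigma> i s] by blast

lemma support_Cons: "permutation \<sigma> \<Longrightarrow> support \<sigma> i = i # tl (support \<sigma> i)"
  using least_power_of_permutation(2)[of \<sigma> i] by (cases "least_power \<sigma> i") (simp_all add: upt_conv_Cons del: upt_Suc)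

text \<open>Cycles are disjoint or equal, and those of \<open>x\<close> and
  \<open>\<sigma> x\<close> share a point.\<close>

lemma apply_in_support_iff:
  assumes "permutation \<sigma>"
  shows "\<sigma> x \<in> set (support \<sigma> i) \<longleftrightarrow> x \<in> set (support \<sigma> i)"
proof -
  have "x \<in> set (support \<sigma> (\<sigma> x)) \<longleftrightarrow> \<sigma> x \<in> set (support \<sigma> x)"
    using in_support_commute[OF assms] .
  moreover have "\<sigma> x \<in> set (support \<sigma> x)"
    unfolding support_set[OF assms] by (rule image_eqI[of _ _ 1]) auto
  ultimately have "set (support \<sigma> x) \<inter> set (support \<sigma> (\<sigma> x)) \<noteq> {}"
    using self_in_support[OF assms, of x] by blast
  hence "set (support \<sigma> x) = set (support \<sigma> (\<sigma> x))"
    using disjoint_support[OF assms] by (meson UNIV_I disjoint_def image_iff)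
  thus ?thesis
    using in_support_commute[OF assms] by metis
qed

lemma support_cong:
  assumes "\<And>k. (f ^^ k) s = (g ^^ k) s"
  shows "support f s = support g s"
  using assms by (simp add: least_power_def)

section \<open>Removing and adding a cycle\<close>

definition restrict_perm :: "('i \<Rightarrow> 'i) \<Rightarrow> 'i \<Rightarrow> 'i \<Rightarrow> 'i" where
  "restrict_perm \<sigma> i x = (if x \<in> set (support \<sigma> i) then x else \<sigma> x)"

definition extend_perm :: "('i \<Rightarrow> 'i) \<Rightarrow> 'i list \<Rightarrow> 'i \<Rightarrow> 'i" where
  "extend_perm \<tau> c x = (if x \<in> set c then cycle_of_list c x else \<tau> x)"

lemma support_subset:
  assumes "finite T" "\<sigma> permutes T" "i \<in> T"
  shows "set (support \<sigma> i) \<subseteq> T"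
  using assms permutes_in_image[OF permutes_funpow[OF assms(2)], of _ i] by auto

lemma restrict_perm_permutes:
  assumes "finite T" "\<sigma> permutes T"
  shows "restrict_perm \<sigma> i permutes T - set (support \<sigma> i)"
proof -
  define C where "C = set (support \<sigma> i)"
  have C: "\<sigma> x \<in> C \<longleftrightarrow> x \<in> C" for x
    unfolding C_def by (rule apply_in_support_iff[OF permutation_if_permutes[OF assms]])
  have r: "restrict_perm \<sigma> i = (\<lambda>x. if x \<in> C then x else \<sigma> x)"
    by (simp only: restrict_perm_def C_def fun_eq_iff simp_thms)
  have "\<exists>!x. restrict_perm \<sigma> i x = y" for y
  proof -
    obtain x where x: "\<sigma> x = y" "\<And>x'. \<sigma> x' = y \<Longrightarrow> x' = x"
      using assms(2) unfolding permutes_def by metis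
    show ?thesis
    proof (rule ex1I[of _ "if y \<in> C then y else x"])
      show "restrict_perm \<sigma> i (if y \<in> C then y else x) = y"
        using x(1) C[of x] by (simp add: r)
      fix x' assume "restrict_perm \<sigma> i x' = y"
      thus "x' = (if y \<in> C then y else x)"
        using x(2)[of x'] C[of x'] by (auto simp: r split: if_splits)
    qed
  qed
  moreover have "restrict_perm \<sigma> i x = x" if "x \<notin> T - C" for x
    using that permutes_not_in[OF assms(2)] by (auto simp: r)
  ultimately show ?thesis unfolding permutes_def C_def by blast
qed

text \<open>The iterates of \<open>s\<close> never enter the removed cycle, so both permutations
  have the same orbit there.\<close>

lemma support_restrict_perm:
  assumes p: "permutation \<sigma>" and s: "s \<notin> set (support \<sigma> i)"
  shows "support (restrict_perm \<sigma> i) s = support \<sigma> s"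
proof (rule support_cong)
  fix k
  have "(restrict_perm \<sigma> i ^^ k) s = (\<sigma> ^^ k) s \<and> (\<sigma> ^^ k) s \<notin> set (support \<sigma> i)"
    by (induction k) (use s in \<open>auto simp: restrict_perm_def apply_in_support_iff[OF p] simp del: set_map\<close>)
  thus "(restrict_perm \<sigma> i ^^ k) s = (\<sigma> ^^ k) s" by blast
qed

lemma extend_perm_permutes:
  assumes c: "distinct c" "set c \<subseteq> T" and \<tau>: "\<tau> permutes T - set c"
  shows "extend_perm \<tau> c permutes T"
proof -
  have "extend_perm \<tau> c = cycle_of_list c \<circ> \<tau>"
  proof
    fix x show "extend_perm \<tau> c x = (cycle_of_list c \<circ> \<tau>) x"
      using permutes_in_image[OF \<tau>, of x] permutes_not_in[OF \<tau>, of x]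
      by (cases "x \<in> T") (auto simp: extend_perm_def id_outside_supp)
  qed
  moreover have "cycle_of_list c permutes T"
    using cycle_permutes c(2) by (rule permutes_subset)
  moreover have "\<tau> permutes T"
    using \<tau> by (rule permutes_subset) auto
  ultimately show ?thesis by (simp add: permutes_compose)
qed

text \<open>The iterates of \<open>i\<close> run through the list cyclically, and distinctness makes
  its length the first return time.\<close>

lemma support_extend_perm:
  assumes "distinct (i # u)"
  shows "support (extend_perm \<tau> (i # u)) i = i # u"
proof -
  let ?c = "i # u" let ?\<sigma> = "extend_perm \<tau> ?c"
  have pow: "(?\<sigma> ^^ k) i = ?c ! (k mod length ?c)" for k
  proof (induction k)
    case (Suc k)
    let ?m = "k mod length ?c"
    have m: "?m < length ?c" by simp
    \<comment> \<open>On its own list, \<open>cycle_of_list\<close> acts as rotation by one, which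
      moves each position to its successor modulo the length.\<close>
    have "cycle_of_list ?c (?c ! ?m) = map (cycle_of_list ?c ^^ 1) ?c ! ?m"
      using nth_map[OF m, of "cycle_of_list ?c ^^ 1"] by simp
    also have "\<dots> = rotate 1 ?c ! ?m"
      unfolding cyclic_rotation[OF assms] ..
    also have "\<dots> = ?c ! (Suc ?m mod length ?c)"
      using m nth_rotate[OF m, of 1] by simp
    finally have "cycle_of_list ?c (?c ! ?m) = ?c ! (Suc k mod length ?c)"
      by (simp only: mod_Suc_eq)
    moreover have "?c ! ?m \<in> set ?c" using m by (rule nth_mem)
    ultimately show ?case using Suc.IH by (simp add: extend_perm_def del: list.set)
  qed simp
  have "least_power ?\<sigma> i = length ?c"
    unfolding least_power_def
  proof (rule Least_equality)
    show "(?\<sigma> ^^ length ?c) i = i \<and> 0 < length ?c" unfolding pow by simp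
    fix k assume k: "(?\<sigma> ^^ k) i = i \<and> 0 < k"
    show "length ?c \<le> k"
    proof (rule ccontr)
      assume "\<not> length ?c \<le> k"
      hence "?c ! k = ?c ! 0" "k < length ?c" using k unfolding pow by auto
      thus False using k nth_eq_iff_index_eq[OF assms, of k 0] by auto
    qed
  qed
  moreover have "map (\<lambda>k. (?\<sigma> ^^ k) i) [0..<length ?c] = ?c"
    unfolding pow by (rule nth_equalityI) (simp_all del: upt_Suc)
  ultimately show ?thesis by simp
qed

text \<open>A permutation of \<open>T\<close> amounts to its cycle through \<open>i\<close> together
  with a permutation of the remaining indices; \<open>extend_perm\<close> reassembles the
  two.\<close>

lemma sum_permutations_by_cycle:
  assumes T: "finite T" "i \<in> T"
  shows "(\<Sum>\<sigma> | \<sigma> permutes T. g (tl (support \<sigma> i)) (restrict_perm \<sigma> i))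
       = (\<Sum>u\<in>distinct_lists (T - {i}). \<Sum>\<tau> | \<tau> permutes T - {i} - set u. g u \<tau>)"
proof -
  have U: "T - set (i # u) = T - {i} - set u" for u by auto
  have inverse: "tl (support (extend_perm \<tau> (i # u)) i) = u" "restrict_perm (extend_perm \<tau> (i # u)) i = \<tau>"
    if u: "u \<in> distinct_lists (T - {i})" and \<tau>: "\<tau> permutes T - {i} - set u" for u \<tau>
  proof -
    have s: "support (extend_perm \<tau> (i # u)) i = i # u"
      using u by (intro support_extend_perm) (auto simp: distinct_lists_def)
    show "tl (support (extend_perm \<tau> (i # u)) i) = u" unfolding s by simp
    show "restrict_perm (extend_perm \<tau> (i # u)) i = \<tau>"
      using permutes_not_in[OF \<tau>] unfolding restrict_perm_def s by (auto simp: fun_eq_iff extend_perm_def)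
  qed
  have "(\<Sum>u\<in>distinct_lists (T - {i}). \<Sum>\<tau> | \<tau> permutes T - {i} - set u. g u \<tau>)
      = (\<Sum>(u, \<tau>)\<in>(SIGMA u:distinct_lists (T - {i}). {\<tau>. \<tau> permutes T - {i} - set u}). g u \<tau>)"
    using T by (subst sum.Sigma) (auto simp: finite_permutations)
  also have "\<dots> = (\<Sum>\<sigma> | \<sigma> permutes T. g (tl (support \<sigma> i)) (restrict_perm \<sigma> i))"
  proof (rule sum.reindex_bij_witness[of _ "\<lambda>\<sigma>. (tl (support \<sigma> i), restrict_perm \<sigma> i)"
        "\<lambda>(u, \<tau>). extend_perm \<tau> (i # u)"], goal_cases)
    case (1 p)
    thus ?case using inverse by fastforce
  next
    case (2 p)
    then obtain u \<tau> where p: "p = (u, \<tau>)" and u': "u \<in> distinct_lists (T - {i})"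
      and \<tau>: "\<tau> permutes T - set (i # u)"
      unfolding U by auto
    have u: "distinct (i # u)" "set (i # u) \<subseteq> T"
      using u' T by (auto simp: distinct_lists_def)
    show ?case using extend_perm_permutes[OF u \<tau>] by (simp add: p)
  next
    case (3 \<sigma>)
    hence \<sigma>: "\<sigma> permutes T" and p: "permutation \<sigma>" using T permutation_if_permutes by auto
    have "cycle_of_list (support \<sigma> i) x = \<sigma> x" if "x \<in> set (support \<sigma> i)" for x
      using cycle_restrict[OF p that] ..
    thus ?case
      unfolding prod.case support_Cons[OF p, symmetric]
      by (auto simp: fun_eq_iff extend_perm_def restrict_perm_def simp del: set_map)
  next
    case (4 \<sigma>)
    hence \<sigma>: "\<sigma> permutes T" and p: "permutation \<sigma>" using T permutation_if_permutes by auto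
    have s: "support \<sigma> i = i # tl (support \<sigma> i)" by (rule support_Cons[OF p])
    have "distinct (i # tl (support \<sigma> i))" "set (i # tl (support \<sigma> i)) \<subseteq> T"
      using cycle_of_permutation[OF p, of i] support_subset[OF T(1) \<sigma> T(2)] unfolding s[symmetric] .
    moreover have "restrict_perm \<sigma> i permutes T - set (i # tl (support \<sigma> i))"
      using restrict_perm_permutes[OF T(1) \<sigma>, of i] unfolding s[symmetric] .
    ultimately show ?case unfolding U by (auto simp: distinct_lists_def)
  next
    case (5 p)
    thus ?case using inverse by fastforce
  qed
  finally show ?thesis ..
qed

section \<open>Cycle products and the elements opening the cycles\<close>

definition cyc_prod :: "('i \<Rightarrow> 'i \<Rightarrow> quat) \<Rightarrow> ('i \<Rightarrow> 'i) \<Rightarrow> 'i \<Rightarrow> quat" where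
  "cyc_prod a \<sigma> s = prod_list (map (\<lambda>t. a t (\<sigma> t)) (support \<sigma> s))"

text \<open>The induction runs over initial segments of the orbit, which need not close up; the
  return to \<open>s\<close> enters only at the full length
  \<open>least_power \<sigma> s\<close>.\<close>

lemma cyc_prod_eq_path_prod:
  assumes p: "permutation \<sigma>"
  shows "cyc_prod a \<sigma> s = path_prod a (support \<sigma> s @ [s])"
proof -
  have "path_prod a (map (\<lambda>k. (\<sigma> ^^ k) s) [0..<Suc n])
      = prod_list (map (\<lambda>t. a t (\<sigma> t)) (map (\<lambda>k. (\<sigma> ^^ k) s) [0..<n]))" for n
  proof (induction n)
    case (Suc n)
    have "path_prod a (map (\<lambda>k. (\<sigma> ^^ k) s) [0..<Suc (Suc n)])
        = path_prod a (map (\<lambda>k. (\<sigma> ^^ k) s) [0..<Suc n]) * a ((\<sigma> ^^ n) s) ((\<sigma> ^^ Suc n) s)"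
      using path_prod_snoc[of "map (\<lambda>k. (\<sigma> ^^ k) s) [0..<Suc n]"] by (simp add: last_map)
    thus ?case using Suc.IH by simp
  qed simp
  from this[of "least_power \<sigma> s"] show ?thesis
    using least_power_of_permutation(1)[OF p, of s] by (simp add: cyc_prod_def)
qed

text \<open>The openings when no index is distinguished, as for the cycles left after the first one
  is split off.\<close>

definition min_heads :: "nat set \<Rightarrow> (nat \<Rightarrow> nat) \<Rightarrow> nat list" where
  "min_heads T \<sigma> = filter (\<lambda>s. \<forall>t\<in>set (support \<sigma> s). s \<le> t) (sorted_list_of_set T)"

definition heads :: "nat set \<Rightarrow> nat \<Rightarrow> (nat \<Rightarrow> nat) \<Rightarrow> nat list" where
  "heads T i \<sigma> = i # filter (\<lambda>s. i \<notin> set (support \<sigma> s) \<and> (\<forall>t\<in>set (support \<sigma> s). s \<le> t)) (sorted_list_of_set T)"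

lemma cycle_heads_eq_heads: "cycle_heads n i \<sigma> = heads {0..<n} i \<sigma>"
  by (simp add: cycle_heads_def heads_def)

lemma sorted_list_of_set_Diff:
  "finite T \<Longrightarrow> sorted_list_of_set (T - C) = filter (\<lambda>s. s \<notin> C) (sorted_list_of_set T)"
  by (rule sorted_distinct_set_unique) (auto simp: sorted_wrt_filter)

text \<open>The cycles that miss \<open>i\<close> are cycles of
  \<open>restrict_perm \<sigma> i\<close> with unchanged supports, so they keep their least
  elements.\<close>

lemma heads_eq:
  assumes T: "finite T" and \<sigma>: "\<sigma> permutes T"
  shows "heads T i \<sigma> = i # min_heads (T - set (support \<sigma> i)) (restrict_perm \<sigma> i)"
proof -
  note p = permutation_if_permutes[OF T \<sigma>]
  have "filter (\<lambda>s. i \<notin> set (support \<sigma> s) \<and> (\<forall>t\<in>set (support \<sigma> s). s \<le> t)) (sorted_list_of_set T)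
      = filter (\<lambda>s. s \<notin> set (support \<sigma> i) \<and> (\<forall>t\<in>set (support (restrict_perm \<sigma> i) s). s \<le> t)) (sorted_list_of_set T)"
    by (rule filter_cong[OF refl]) (metis in_support_commute[OF p] support_restrict_perm[OF p])
  thus ?thesis
    by (simp only: heads_def min_heads_def sorted_list_of_set_Diff[OF T] filter_filter)
qed

text \<open>The least index of \<open>T\<close> opens its own cycle and comes first; no other
  opening can lie in that cycle. Thus the expansion along an opening index also applies to the
  remaining cycles.\<close>

lemma min_heads_eq_heads:
  assumes T: "finite T" "T \<noteq> {}" and \<sigma>: "\<sigma> permutes T"
  shows "min_heads T \<sigma> = heads T (Min T) \<sigma>"
proof -
  note p = permutation_if_permutes[OF T(1) \<sigma>]
  let ?m = "Min T" let ?P = "\<lambda>s. \<forall>t\<in>set (support \<sigma> s). s \<le> t"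
  have m: "?m \<in> T" using T by simp
  have sl: "sorted_list_of_set T = ?m # sorted_list_of_set (T - {?m})"
    using T by (simp add: sorted_list_of_set_nonempty)
  have "?P ?m" using support_subset[OF T(1) \<sigma> m] T by auto
  moreover have "filter ?P (sorted_list_of_set (T - {?m}))
      = filter (\<lambda>s. ?m \<notin> set (support \<sigma> s) \<and> ?P s) (sorted_list_of_set (T - {?m}))"
  proof (rule filter_cong[OF refl])
    fix s assume "s \<in> set (sorted_list_of_set (T - {?m}))"
    hence "s \<in> T" "s \<noteq> ?m" using T by auto
    hence "\<not> s \<le> ?m" using T Min_le[of T s] by linarith
    thus "?P s \<longleftrightarrow> ?m \<notin> set (support \<sigma> s) \<and> ?P s" by blast
  qed
  ultimately show ?thesis
    unfolding min_heads_def heads_def sl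
    using self_in_support[OF p, of ?m] by (simp del: set_map)
qed

section \<open>Row and column determinants over index sets\<close>

definition row_sum :: "(nat \<Rightarrow> nat \<Rightarrow> quat) \<Rightarrow> nat set \<Rightarrow> nat \<Rightarrow> quat" where
  "row_sum a T i = (\<Sum>\<sigma> | \<sigma> permutes T. (- 1) ^ (card T - length (heads T i \<sigma>)) *
     prod_list (map (cyc_prod a \<sigma>) (heads T i \<sigma>)))"

definition col_sum :: "(nat \<Rightarrow> nat \<Rightarrow> quat) \<Rightarrow> nat set \<Rightarrow> nat \<Rightarrow> quat" where
  "col_sum a T i = (\<Sum>\<sigma> | \<sigma> permutes T. (- 1) ^ (card T - length (heads T i \<sigma>)) *
     prod_list (map (cyc_prod a \<sigma>) (rev (heads T i \<sigma>))))"

text \<open>The factor that the cycles after the opening one contribute to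
  \<open>row_sum\<close>.\<close>

definition row_sum_min :: "(nat \<Rightarrow> nat \<Rightarrow> quat) \<Rightarrow> nat set \<Rightarrow> quat" where
  "row_sum_min a T = (\<Sum>\<sigma> | \<sigma> permutes T. (- 1) ^ (card T - length (min_heads T \<sigma>)) *
     prod_list (map (cyc_prod a \<sigma>) (min_heads T \<sigma>)))"

definition col_sum_min :: "(nat \<Rightarrow> nat \<Rightarrow> quat) \<Rightarrow> nat set \<Rightarrow> quat" where
  "col_sum_min a T = (\<Sum>\<sigma> | \<sigma> permutes T. (- 1) ^ (card T - length (min_heads T \<sigma>)) *
     prod_list (map (cyc_prod a \<sigma>) (rev (min_heads T \<sigma>))))"

lemma length_min_heads_le: "length (min_heads T \<sigma>) \<le> card T"
  unfolding min_heads_def using length_filter_le[of _ "sorted_list_of_set T"] by (simp del: length_filter_le)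

text \<open>Splitting off the cycle through \<open>i\<close> leaves the other cycle products
  unchanged and accounts for \<open>length u\<close> in the exponent of the sign.\<close>

lemma map_cyc_prod_heads:
  assumes T: "finite T" "i \<in> T" and \<sigma>: "\<sigma> permutes T"
  defines "u \<equiv> tl (support \<sigma> i)" and "\<tau> \<equiv> restrict_perm \<sigma> i"
  shows "map (cyc_prod a \<sigma>) (heads T i \<sigma>)
       = path_prod a (i # u @ [i]) # map (cyc_prod a \<tau>) (min_heads (T - {i} - set u) \<tau>)"
    and "card T - length (heads T i \<sigma>)
       = length u + (card (T - {i} - set u) - length (min_heads (T - {i} - set u) \<tau>))"
proof -
  note p = permutation_if_permutes[OF T(1) \<sigma>]
  have s: "support \<sigma> i = i # u" unfolding u_def by (rule support_Cons[OF p])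
  have d: "distinct (i # u)" "set (i # u) \<subseteq> T"
    using cycle_of_permutation[OF p, of i] support_subset[OF T(1) \<sigma> T(2)] unfolding s .
  have U: "T - set (support \<sigma> i) = T - {i} - set u" unfolding s by auto
  note h = heads_eq[OF T(1) \<sigma>, of i, unfolded U, folded \<tau>_def]
  have "cyc_prod a \<sigma> s = cyc_prod a \<tau> s" if "s \<in> set (min_heads (T - {i} - set u) \<tau>)" for s
  proof -
    have s': "s \<notin> set (support \<sigma> i)"
      using that T U by (auto simp: min_heads_def simp del: set_map)
    have "t \<notin> set (support \<sigma> i)" if "t \<in> set (support \<sigma> s)" for t
      using that s' disjoint_support'[OF p, of s i] by blast
    hence "map (\<lambda>t. a t (\<sigma> t)) (support \<sigma> s) = map (\<lambda>t. a t (\<tau> t)) (support \<sigma> s)"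
      unfolding \<tau>_def restrict_perm_def by (intro map_cong[OF refl]) presburger
    thus ?thesis
      unfolding cyc_prod_def \<tau>_def support_restrict_perm[OF p s'] by (simp only:)
  qed
  moreover have "cyc_prod a \<sigma> i = path_prod a (i # u @ [i])"
    unfolding cyc_prod_eq_path_prod[OF p] s by simp
  ultimately show "map (cyc_prod a \<sigma>) (heads T i \<sigma>)
       = path_prod a (i # u @ [i]) # map (cyc_prod a \<tau>) (min_heads (T - {i} - set u) \<tau>)"
    unfolding h by simp
  \<comment> \<open>Subtraction in the exponents is truncated, so both numbers of cycles must be
    bounded by cardinalities.\<close>
  have "card (T - set (i # u)) = card T - length (i # u)"
    using d T by (subst card_Diff_subset) (simp_all add: distinct_card[OF d(1), simplified])
  moreover have "length (i # u) \<le> card T"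
    using card_mono[OF T(1) d(2)] distinct_card[OF d(1)] by simp
  moreover have "T - set (i # u) = T - {i} - set u" by auto
  ultimately show "card T - length (heads T i \<sigma>)
       = length u + (card (T - {i} - set u) - length (min_heads (T - {i} - set u) \<tau>))"
    unfolding h using length_min_heads_le[of "T - {i} - set u" \<tau>] by simp
qed

lemma row_sum_expand:
  assumes T: "finite T" "i \<in> T"
  shows "row_sum a T i = (\<Sum>u\<in>distinct_lists (T - {i}).
           (- 1) ^ length u * path_prod a (i # u @ [i]) * row_sum_min a (T - {i} - set u))"
proof -
  \<comment> \<open>\<open>g\<close> sees a permutation only through its opening cycle and its
    restriction, as the reindexing requires.\<close>
  define g where "g = (\<lambda>u \<tau>. (- 1) ^ (length u + (card (T - {i} - set u) - length (min_heads (T - {i} - set u) \<tau>))) *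
    prod_list (path_prod a (i # u @ [i]) # map (cyc_prod a \<tau>) (min_heads (T - {i} - set u) \<tau>)))"
  have "row_sum a T i = (\<Sum>\<sigma> | \<sigma> permutes T. g (tl (support \<sigma> i)) (restrict_perm \<sigma> i))"
    unfolding row_sum_def g_def by (intro sum.cong refl) (simp only: mem_Collect_eq map_cyc_prod_heads[OF T])
  also have "\<dots> = (\<Sum>u\<in>distinct_lists (T - {i}). \<Sum>\<tau> | \<tau> permutes T - {i} - set u. g u \<tau>)"
    by (rule sum_permutations_by_cycle[OF T])
  also have "\<dots> = (\<Sum>u\<in>distinct_lists (T - {i}).
           (- 1) ^ length u * path_prod a (i # u @ [i]) * row_sum_min a (T - {i} - set u))"
    unfolding row_sum_min_def sum_distrib_left g_def
    by (intro sum.cong refl) (simp add: minus_one_power_mult power_add)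
  finally show ?thesis .
qed

text \<open>Reversing the list of cycles moves the product of the opening cycle to the right; the
  order inside each cycle stays.\<close>

lemma col_sum_expand:
  assumes T: "finite T" "i \<in> T"
  shows "col_sum a T i = (\<Sum>u\<in>distinct_lists (T - {i}).
           (- 1) ^ length u * col_sum_min a (T - {i} - set u) * path_prod a (i # u @ [i]))"
proof -
  define g where "g = (\<lambda>u \<tau>. (- 1) ^ (length u + (card (T - {i} - set u) - length (min_heads (T - {i} - set u) \<tau>))) *
    prod_list (rev (path_prod a (i # u @ [i]) # map (cyc_prod a \<tau>) (min_heads (T - {i} - set u) \<tau>))))"
  have "col_sum a T i = (\<Sum>\<sigma> | \<sigma> permutes T. g (tl (support \<sigma> i)) (restrict_perm \<sigma> i))"
    unfolding col_sum_def g_def by (intro sum.cong refl) (simp only: mem_Collect_eq rev_map[symmetric] map_cyc_prod_heads[OF T])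
  also have "\<dots> = (\<Sum>u\<in>distinct_lists (T - {i}). \<Sum>\<tau> | \<tau> permutes T - {i} - set u. g u \<tau>)"
    by (rule sum_permutations_by_cycle[OF T])
  also have "\<dots> = (\<Sum>u\<in>distinct_lists (T - {i}).
           (- 1) ^ length u * col_sum_min a (T - {i} - set u) * path_prod a (i # u @ [i]))"
    unfolding col_sum_min_def sum_distrib_left sum_distrib_right g_def
    by (intro sum.cong refl) (simp add: power_add mult.assoc rev_map)
  finally show ?thesis .
qed

lemma row_sum_min_eq: "finite T \<Longrightarrow> T \<noteq> {} \<Longrightarrow> row_sum_min a T = row_sum a T (Min T)"
  unfolding row_sum_min_def row_sum_def by (intro sum.cong refl) (simp add: min_heads_eq_heads)

lemma col_sum_min_eq: "finite T \<Longrightarrow> T \<noteq> {} \<Longrightarrow> col_sum_min a T = col_sum a T (Min T)"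
  unfolding col_sum_min_def col_sum_def by (intro sum.cong refl) (simp add: min_heads_eq_heads)

text \<open>Agreement of \<open>b\<close> with \<open>a\<close> is asked only on \<open>T\<close>,
  so the result applies to a matrix with a replaced row or column once its index is outside
  \<open>T\<close>. By induction the remaining cycles contribute a real factor, so its side does not
  matter.\<close>

lemma sum_min_hermitian:
  assumes a: "hermitian_fun a" and T: "finite T" and b: "\<And>x y. x \<in> T \<Longrightarrow> y \<in> T \<Longrightarrow> b x y = a x y"
  shows "row_sum_min b T = of_real (moore_det a T)" "col_sum_min b T = of_real (moore_det a T)"
proof -
  have "row_sum_min b T = of_real (moore_det a T) \<and> col_sum_min b T = of_real (moore_det a T)"
    using T b
  proof (induction "card T" arbitrary: T rule: less_induct)
    case less
    show ?case
    proof (cases "T = {}")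
      case True
      have "{\<sigma>. \<sigma> permutes ({}::nat set)} = {id}" by auto
      thus ?thesis
        using True by (simp add: row_sum_min_def col_sum_min_def min_heads_def)
    next
      case False
      let ?m = "Min T"
      have m: "?m \<in> T" using False less.prems by simp
      have IH: "row_sum_min b (T - {?m} - set u) = of_real (moore_det a (T - {?m} - set u))"
        "col_sum_min b (T - {?m} - set u) = of_real (moore_det a (T - {?m} - set u))" for u
      proof -
        have "T - {?m} - set u \<subset> T" using m by blast
        hence "card (T - {?m} - set u) < card T" using less.prems by (simp add: psubset_card_mono)
        thus "row_sum_min b (T - {?m} - set u) = of_real (moore_det a (T - {?m} - set u))"
          "col_sum_min b (T - {?m} - set u) = of_real (moore_det a (T - {?m} - set u))"
          using less.hyps[of "T - {?m} - set u"] less.prems by simp_all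
      qed
      have path: "path_prod b (?m # u @ [?m]) = path_prod a (?m # u @ [?m])"
        if "u \<in> distinct_lists (T - {?m})" for u
        using that m less.prems(2) by (intro path_prod_cong) (auto simp: distinct_lists_def)
      show ?thesis
        unfolding row_sum_min_eq[OF less.prems(1) False] col_sum_min_eq[OF less.prems(1) False]
          row_sum_expand[OF less.prems(1) m] col_sum_expand[OF less.prems(1) m] IH
          moore_det_expand_hermitian[OF a less.prems(1) m, symmetric]
        by (auto intro!: sum.cong simp: path mult.assoc minus_one_power_mult of_real_def)
    qed
  qed
  thus "row_sum_min b T = of_real (moore_det a T)" "col_sum_min b T = of_real (moore_det a T)" by auto
qed

section \<open>Cramer rules for Hermitian matrices\<close>

text \<open>The zero padding makes Hermitian symmetry and the product rule hold at all indices, not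
  only at those below the dimension.\<close>

definition entry :: "quat mat \<Rightarrow> nat \<Rightarrow> nat \<Rightarrow> quat" where
  "entry M i j = (if i < dim_row M \<and> j < dim_col M then M $$ (i, j) else 0)"

lemma qadj_carrier [simp]: "A \<in> carrier_mat n m \<Longrightarrow> qadj A \<in> carrier_mat m n"
  by (auto simp: qadj_def)

lemma index_qadj [simp]: "i < dim_col A \<Longrightarrow> j < dim_row A \<Longrightarrow> qadj A $$ (i, j) = qcnj (A $$ (j, i))"
  by (simp add: qadj_def)

lemma qadj_qadj [simp]: "qadj (qadj A) = A"
  by (rule eq_matI) (auto simp: qadj_def)

lemma index_mult_mat_sum:
  "A \<in> carrier_mat n m \<Longrightarrow> B \<in> carrier_mat m k \<Longrightarrow> i < n \<Longrightarrow> j < k \<Longrightarrow>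
    (A * B) $$ (i, j) = (\<Sum>l<m. A $$ (i, l) * B $$ (l, j))"
  by (simp add: scalar_prod_def lessThan_atLeast0)

lemma qadj_mult:
  assumes A: "A \<in> carrier_mat n m" and B: "B \<in> carrier_mat m k"
  shows "qadj (A * B) = qadj B * qadj A"
proof (rule eq_matI)
  fix i j assume "i < dim_row (qadj B * qadj A)" "j < dim_col (qadj B * qadj A)"
  hence "i < k" "j < n" using A B by (auto simp: qadj_def)
  thus "qadj (A * B) $$ (i, j) = (qadj B * qadj A) $$ (i, j)"
    using A B by (simp add: index_mult_mat_sum[OF A B]
        index_mult_mat_sum[OF qadj_carrier[OF B] qadj_carrier[OF A]] qcnj_sum del: index_mult_mat(1))
qed (use A B in \<open>auto simp: qadj_def\<close>)

lemma entry_mult: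
  assumes "A \<in> carrier_mat n n" "B \<in> carrier_mat n n"
  shows "entry (A * B) = fmul {0..<n} (entry A) (entry B)"
  using assms by (auto simp: fun_eq_iff entry_def fmul_def scalar_prod_def intro!: sum.cong)

lemma hermitian_entry: "qadj M = M \<Longrightarrow> hermitian_fun (entry M)"
proof -
  assume M: "qadj M = M"
  have dim: "dim_row M = dim_col M" by (subst M[symmetric]) (simp add: qadj_def)
  have "entry M j i = qcnj (entry M i j)" for i j
  proof (cases "i < dim_col M \<and> j < dim_col M")
    case True
    hence "M $$ (j, i) = qcnj (M $$ (i, j))"
      using dim index_qadj[of j M i] unfolding M by simp
    thus ?thesis using True by (simp add: entry_def dim)
  qed (auto simp: entry_def dim)
  thus ?thesis unfolding hermitian_fun_def by blast
qed

section \<open>Matrix determinants as sums over the index set\<close>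

lemma map_cycle_prod_heads:
  assumes M: "M \<in> carrier_mat n n" and i: "i < n" and \<sigma>: "\<sigma> permutes {0..<n}"
  shows "map (cycle_prod M \<sigma>) (heads {0..<n} i \<sigma>) = map (cyc_prod (entry M) \<sigma>) (heads {0..<n} i \<sigma>)"
proof (rule map_cong[OF refl])
  fix s assume "s \<in> set (heads {0..<n} i \<sigma>)"
  hence "s \<in> {0..<n}" using i by (auto simp: heads_def)
  hence "set (support \<sigma> s) \<subseteq> {0..<n}" using support_subset[OF _ \<sigma>] by blast
  hence "M $$ (t, \<sigma> t) = entry M t (\<sigma> t)" if "t \<in> set (support \<sigma> s)" for t
    using that permutes_in_image[OF \<sigma>, of t] M unfolding entry_def by fastforce
  thus "cycle_prod M \<sigma> s = cyc_prod (entry M) \<sigma> s"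
    unfolding cycle_prod_def cyc_prod_def by (intro arg_cong[of _ _ prod_list] map_cong[OF refl])
qed

lemma rdet_eq_row_sum:
  assumes "M \<in> carrier_mat n n" "i < n"
  shows "rdet i M = row_sum (entry M) {0..<n} i"
  using assms unfolding rdet_def Let_def row_sum_def cycle_heads_eq_heads
  by (auto intro!: sum.cong simp: map_cycle_prod_heads)

lemma cdet_eq_col_sum:
  assumes "M \<in> carrier_mat n n" "i < n"
  shows "cdet i M = col_sum (entry M) {0..<n} i"
  using assms unfolding cdet_def Let_def col_sum_def cycle_heads_eq_heads
  by (auto intro!: sum.cong simp: map_cycle_prod_heads simp flip: rev_map)

text \<open>A replaced column affects only steps into its index, and no condition is imposed on
  steps into the starting vertex \<open>i\<close>.\<close>

lemma path_prod_cong_tl: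
  "(\<And>x y. y \<in> set u \<Longrightarrow> a x y = b x y) \<Longrightarrow> path_prod a (i # u) = path_prod b (i # u)"
  by (induction u arbitrary: i) simp_all

text \<open>The counterpart for a replaced row, which affects only steps out of its index.\<close>

lemma path_prod_cong_butlast:
  "(\<And>x y. x \<in> set u \<Longrightarrow> a x y = b x y) \<Longrightarrow> path_prod a (u @ [i]) = path_prod b (u @ [i])"
  by (induction u rule: induct_list012) simp_all

text \<open>The new column enters only through the last step of the cycle opened by
  \<open>i\<close>. All other cycles avoid \<open>i\<close> and form a real minor of the Hermitian
  matrix.\<close>

lemma cdet_replace_col:
  assumes M: "M \<in> carrier_mat n n" "qadj M = M" and i: "i < n" and b: "b \<in> carrier_vec n"
  shows "cdet i (replace_col M b i) = (\<Sum>m<n. moore_cof (entry M) {0..<n} i m * b $ m)"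
proof -
  let ?S = "{0..<n}" let ?a = "entry M" let ?c = "entry (replace_col M b i)"
  have R: "replace_col M b i \<in> carrier_mat n n" using M by (simp add: replace_col_def)
  have c: "?c x y = (if y = i \<and> x < n then b $ x else ?a x y)" for x y
    using M i by (auto simp: entry_def replace_col_def)
  have "cdet i (replace_col M b i) = (\<Sum>u\<in>distinct_lists (?S - {i}).
           (- 1) ^ length u * col_sum_min ?c (?S - {i} - set u) * path_prod ?c (i # u @ [i]))"
    using i by (simp add: cdet_eq_col_sum[OF R i] col_sum_expand)
  also have "\<dots> = (\<Sum>u\<in>distinct_lists (?S - {i}). ((- 1) ^ length u * moore_det ?a (?S - {i} - set u)) *\<^sub>R
      (path_prod ?a (i # u) * b $ last (i # u)))"
  proof (intro sum.cong refl)
    fix u assume "u \<in> distinct_lists (?S - {i})"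
    hence u: "set u \<subseteq> ?S - {i}" by (simp add: distinct_lists_def)
    have "col_sum_min ?c (?S - {i} - set u) = of_real (moore_det ?a (?S - {i} - set u))"
      by (rule sum_min_hermitian[OF hermitian_entry[OF M(2)]]) (auto simp: c)
    moreover have "path_prod ?c (i # u) = path_prod ?a (i # u)"
      using u by (intro path_prod_cong_tl) (auto simp: c)
    moreover have "last (i # u) < n" using u i last_in_set[of "i # u"] by auto
    hence "?c (last (i # u)) i = b $ last (i # u)" by (simp add: c)
    ultimately show "(- 1) ^ length u * col_sum_min ?c (?S - {i} - set u) * path_prod ?c (i # u @ [i])
        = ((- 1) ^ length u * moore_det ?a (?S - {i} - set u)) *\<^sub>R (path_prod ?a (i # u) * b $ last (i # u))"
      using path_prod_snoc[of "i # u" ?c i]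
      by (simp add: mult.assoc minus_one_power_mult of_real_def del: last.simps)
  qed
  also have "\<dots> = (\<Sum>m\<in>?S. moore_cof ?a ?S i m * b $ m)"
    using i by (intro sum_moore_cof[symmetric]) auto
  finally show ?thesis by (simp add: lessThan_atLeast0)
qed

text \<open>The new row enters only through the first step of the cycle opened by \<open>i\<close>.
  Reversing the cycle leads back to the column case, with conjugated cofactors.\<close>

lemma rdet_replace_row:
  assumes M: "M \<in> carrier_mat n n" "qadj M = M" and i: "i < n" and b: "b \<in> carrier_vec n"
  shows "rdet i (replace_row M b i) = (\<Sum>m<n. b $ m * qcnj (moore_cof (entry M) {0..<n} i m))"
proof -
  let ?S = "{0..<n}" let ?a = "entry M" let ?c = "entry (replace_row M b i)"
  have R: "replace_row M b i \<in> carrier_mat n n" using M by (simp add: replace_row_def)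
  have c: "?c x y = (if x = i \<and> y < n then b $ y else ?a x y)" for x y
    using M i by (auto simp: entry_def replace_row_def)
  have "rdet i (replace_row M b i) = (\<Sum>u\<in>distinct_lists (?S - {i}).
           (- 1) ^ length u * path_prod ?c (i # u @ [i]) * row_sum_min ?c (?S - {i} - set u))"
    using i by (simp add: rdet_eq_row_sum[OF R i] row_sum_expand)
  also have "\<dots> = (\<Sum>u\<in>distinct_lists (?S - {i}). ((- 1) ^ length u * moore_det ?a (?S - {i} - set u)) *\<^sub>R
      (b $ hd (u @ [i]) * path_prod ?a (u @ [i])))"
  proof (intro sum.cong refl)
    fix u assume "u \<in> distinct_lists (?S - {i})"
    hence u: "set u \<subseteq> ?S - {i}" by (simp add: distinct_lists_def)
    have "row_sum_min ?c (?S - {i} - set u) = of_real (moore_det ?a (?S - {i} - set u))"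
      by (rule sum_min_hermitian[OF hermitian_entry[OF M(2)]]) (auto simp: c)
    moreover have "path_prod ?c (u @ [i]) = path_prod ?a (u @ [i])"
      using u by (intro path_prod_cong_butlast) (auto simp: c)
    moreover have "hd (u @ [i]) < n" using u i hd_in_set[of "u @ [i]"] by auto
    hence "?c i (hd (u @ [i])) = b $ hd (u @ [i])" by (simp add: c)
    moreover have "path_prod ?c (i # u @ [i]) = ?c i (hd (u @ [i])) * path_prod ?c (u @ [i])"
      by (cases u) simp_all
    ultimately show "(- 1) ^ length u * path_prod ?c (i # u @ [i]) * row_sum_min ?c (?S - {i} - set u)
        = ((- 1) ^ length u * moore_det ?a (?S - {i} - set u)) *\<^sub>R (b $ hd (u @ [i]) * path_prod ?a (u @ [i]))"
      by (simp add: mult.assoc minus_one_power_mult of_real_def)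
  qed
  also have "\<dots> = (\<Sum>u\<in>distinct_lists (?S - {i}). ((- 1) ^ length u * moore_det ?a (?S - {i} - set u)) *\<^sub>R
      (b $ last (i # u) * qcnj (path_prod ?a (i # u))))"
  proof -
    have "path_prod ?a (rev u @ [i]) = qcnj (path_prod ?a (i # u))" for u
      using path_prod_rev[OF hermitian_entry[OF M(2)], of "i # u"] by simp
    moreover have "hd (rev u @ [i]) = last (i # u)" for u
      using hd_rev[of "i # u"] by simp
    ultimately show ?thesis by (subst sum_distinct_lists_rev) (simp del: last.simps)
  qed
  \<comment> \<open>Conjugating the whole sum restores the order of factors needed for
    \<open>sum_moore_cof\<close>.\<close>
  also have "\<dots> = qcnj (\<Sum>m\<in>?S. moore_cof ?a ?S i m * qcnj (b $ m))"
    using i by (subst sum_moore_cof) (auto simp: qcnj_sum)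
  finally show ?thesis by (simp add: lessThan_atLeast0 qcnj_sum)
qed

lemma hdet_eq_moore_det:
  assumes M: "M \<in> carrier_mat n n" "qadj M = M" and n: "n \<ge> 1"
  shows "hdet M = moore_det (entry M) {0..<n}"
proof -
  let ?S = "{0..<n}" let ?a = "entry M"
  note herm = hermitian_entry[OF M(2)]
  note min = sum_min_hermitian[OF herm _ refl]
  have det: "rdet i M = of_real (moore_det ?a ?S)" "cdet i M = of_real (moore_det ?a ?S)" if "i < n" for i
    using that
    by (simp_all add: rdet_eq_row_sum[OF M(1)] cdet_eq_col_sum[OF M(1)] row_sum_expand col_sum_expand min
        mult.assoc minus_one_power_mult moore_det_expand_hermitian[OF herm, of _ i, symmetric])
      (simp_all add: of_real_def)
  have "dim_row M = n" using M by simp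
  \<comment> \<open>Uniqueness in the definite description comes from \<open>n \<ge> 1\<close>,
    which supplies an index.\<close>
  thus ?thesis
    unfolding hdet_def using det n by (intro the_equality) (auto, metis of_real_eq_iff less_eq_Suc_le One_nat_def)
qed

lemma hdet_mult_commute:
  assumes A: "A \<in> carrier_mat n n" and n: "n \<ge> 1"
  shows "hdet (A * qadj A) = hdet (qadj A * A)"
proof -
  have H: "qadj A \<in> carrier_mat n n" using A by simp
  have "qadj (A * qadj A) = A * qadj A" "qadj (qadj A * A) = qadj A * A"
    using qadj_mult[OF A H] qadj_mult[OF H A] by simp_all
  moreover have "A * qadj A \<in> carrier_mat n n" "qadj A * A \<in> carrier_mat n n"
    using mult_carrier_mat[OF A H] mult_carrier_mat[OF H A] .
  ultimately show ?thesis
    using hermitian_entry[of "A * qadj A"] hermitian_entry[of "qadj A * A"]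
      moore_det_fmul_commute[of "{0..<n}" "entry A" "entry (qadj A)"]
    unfolding entry_mult[OF A H, symmetric] entry_mult[OF H A, symmetric]
    by (simp add: hdet_eq_moore_det[OF _ _ n])
qed

text \<open>\<open>L\<close> is the cofactor matrix divided by the determinant;
  \<open>moore_cof_mult\<close> makes it a left inverse.\<close>

lemma hermitian_cramer:
  assumes M: "M \<in> carrier_mat n n" "qadj M = M" and n: "n \<ge> 1" and d: "hdet M \<noteq> 0"
  obtains L where "L \<in> carrier_mat n n" "L * M = 1\<^sub>m n" "M * L = 1\<^sub>m n"
    "\<And>i b. i < n \<Longrightarrow> b \<in> carrier_vec n \<Longrightarrow>
       cdet i (replace_col M b i) = hdet M *\<^sub>R (\<Sum>m<n. L $$ (i, m) * b $ m)"
    "\<And>i b. i < n \<Longrightarrow> b \<in> carrier_vec n \<Longrightarrow>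
       rdet i (replace_row M b i) = hdet M *\<^sub>R (\<Sum>m<n. b $ m * L $$ (m, i))"
proof -
  define L where "L = mat n n (\<lambda>(i, m). inverse (hdet M) *\<^sub>R moore_cof (entry M) {0..<n} i m)"
  have L: "L \<in> carrier_mat n n" by (simp add: L_def)
  have cof: "moore_cof (entry M) {0..<n} i m = hdet M *\<^sub>R L $$ (i, m)" if "i < n" "m < n" for i m
    using that d by (simp add: L_def)
  have LM: "L * M = 1\<^sub>m n"
  proof (rule eq_matI)
    fix i j assume "i < dim_row (1\<^sub>m n)" "j < dim_col (1\<^sub>m n)"
    hence ij: "i < n" "j < n" by simp_all
    have "hdet M *\<^sub>R (L * M) $$ (i, j) = (\<Sum>m\<in>{0..<n}. moore_cof (entry M) {0..<n} i m * entry M m j)"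
      using ij M by (simp add: index_mult_mat_sum[OF L M(1)] cof entry_def scaleR_sum_right
          lessThan_atLeast0 del: index_mult_mat(1))
    also have "\<dots> = hdet M *\<^sub>R (1\<^sub>m n $$ (i, j))"
      using ij moore_cof_mult[OF hermitian_entry[OF M(2)], of "{0..<n}" i j]
      by (simp add: hdet_eq_moore_det[OF M n] of_real_def)
    finally show "(L * M) $$ (i, j) = 1\<^sub>m n $$ (i, j)" using d by simp
  qed (use L M in auto)
  have "qadj (1\<^sub>m n) = 1\<^sub>m n" by (rule eq_matI) (auto simp: qadj_def)
  \<comment> \<open>The adjoint of \<open>L * M = 1\<close> makes \<open>qadj L\<close> a right
    inverse. A left and a right inverse coincide, so \<open>L\<close> is Hermitian and
    two-sided.\<close>
  hence right_inv: "M * qadj L = 1\<^sub>m n" using qadj_mult[OF L M(1)] LM M(2) by simp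
  have "qadj L = (L * M) * qadj L" unfolding LM using L by (intro left_mult_one_mat[symmetric, of _ n n]) simp
  also have "\<dots> = L * (M * qadj L)" using L M by (intro assoc_mult_mat[of _ n n _ n _ n]) auto
  finally have sym: "qadj L = L" using right_inv L by simp
  \<comment> \<open>This turns the conjugated cofactors of the row formula into a column of
    \<open>L\<close>.\<close>
  have "qcnj (L $$ (i, m)) = L $$ (m, i)" if "i < n" "m < n" for i m
    using that L index_qadj[of m L i] by (simp add: sym)
  thus ?thesis
    using that[OF L LM] right_inv sym
    by (simp add: cdet_replace_col[OF M] rdet_replace_row[OF M] cof scaleR_sum_right)
qed

section \<open>The two-sided equation\<close>

theorem theorem3p3:
  fixes n :: nat and A B C :: "quat mat"
  assumes "n \<ge> 1"
    and "A \<in> carrier_mat n n" and "B \<in> carrier_mat n n" and "C \<in> carrier_mat n n"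
    and "ddet A \<noteq> 0" and "ddet B \<noteq> 0"
  shows "(\<exists>!X. X \<in> carrier_mat n n \<and> A * X * B = C) \<and>
    (\<forall>X \<in> carrier_mat n n. A * X * B = C \<longrightarrow>
      (\<forall>i < n. \<forall>j < n.
        X $$ (i, j) = rdet j (replace_row (B * qadj B) (cA_row A B C i) j)
                        / of_real (ddet A * ddet B) \<and>
        X $$ (i, j) = cdet i (replace_col (qadj A * A) (cB_col A B C j) i)
                        / of_real (ddet A * ddet B)))"
proof -
  note n = assms(1) and A = assms(2) and B = assms(3) and C = assms(4)
  have A': "qadj A \<in> carrier_mat n n" and B': "qadj B \<in> carrier_mat n n" using A B by simp_all
  note sq = mult_carrier_mat[of _ n n _ n]
  have Ct: "ctilde A B C \<in> carrier_mat n n" unfolding ctilde_def by (intro sq A' B' C)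
  have herm: "qadj (qadj Y * Y) = qadj Y * Y" "qadj (Y * qadj Y) = Y * qadj Y"
    if "Y \<in> carrier_mat n n" for Y
    using qadj_mult[OF that qadj_carrier[OF that]] qadj_mult[OF qadj_carrier[OF that] that] by simp_all
  \<comment> \<open>\<open>ddet\<close> is defined by the product with the adjoint on the left; here
    the other order is needed as well.\<close>
  have dB: "hdet (B * qadj B) = ddet B" and dA: "hdet (A * qadj A) = ddet A"
    using hdet_mult_commute[OF _ n] A B by (simp_all add: ddet_def)
  \<comment> \<open>\<open>P\<close> and \<open>Q\<close> invert the two matrices in the formulas;
    they serve uniqueness and the entries. \<open>P2\<close> and \<open>Q2\<close> invert the
    products in the opposite order and serve existence.\<close>
  obtain P where P: "P \<in> carrier_mat n n" "P * (qadj A * A) = 1\<^sub>m n"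
    and cdetA: "\<And>i b. i < n \<Longrightarrow> b \<in> carrier_vec n \<Longrightarrow>
       cdet i (replace_col (qadj A * A) b i) = ddet A *\<^sub>R (\<Sum>m<n. P $$ (i, m) * b $ m)"
    by (rule hermitian_cramer[OF sq[OF A' A] herm(1)[OF A] n, folded ddet_def, OF assms(5)]) (rule that)
  obtain Q where Q: "Q \<in> carrier_mat n n" "(B * qadj B) * Q = 1\<^sub>m n"
    and rdetB: "\<And>i b. i < n \<Longrightarrow> b \<in> carrier_vec n \<Longrightarrow>
       rdet i (replace_row (B * qadj B) b i) = ddet B *\<^sub>R (\<Sum>m<n. b $ m * Q $$ (m, i))"
    by (rule hermitian_cramer[OF sq[OF B B'] herm(2)[OF B] n, unfolded dB, OF assms(6)]) (rule that)
  obtain P2 where P2: "P2 \<in> carrier_mat n n" "(A * qadj A) * P2 = 1\<^sub>m n"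
    by (rule hermitian_cramer[OF sq[OF A A'] herm(2)[OF A] n, unfolded dA, OF assms(5)]) (rule that)
  obtain Q2 where Q2: "Q2 \<in> carrier_mat n n" "Q2 * (qadj B * B) = 1\<^sub>m n"
    by (rule hermitian_cramer[OF sq[OF B' B] herm(1)[OF B] n, folded ddet_def, OF assms(6)]) (rule that)
  define W where "W = P * ctilde A B C * Q"
  have W: "W \<in> carrier_mat n n" unfolding W_def by (intro sq P Q Ct)

  \<comment> \<open>Multiplying the equation by \<open>qadj A\<close> on the left and
    \<open>qadj B\<close> on the right puts \<open>X\<close> between two invertible Hermitian
    matrices.\<close>
  have solution: "X = W" if X: "X \<in> carrier_mat n n" "A * X * B = C" for X
  proof -
    have "ctilde A B C = (qadj A * A) * (X * (B * qadj B))"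
      unfolding ctilde_def X(2)[symmetric] using A A' B B' X(1)
      by (simp add: assoc_mult_mat[of _ n n _ n _ n] sq)
    hence "W = (P * (qadj A * A)) * (X * ((B * qadj B) * Q))"
      unfolding W_def using A A' B B' X(1) P(1) Q(1) by (simp add: assoc_mult_mat[of _ n n _ n _ n] sq)
    thus ?thesis using P Q X(1) by simp
  qed
  \<comment> \<open>\<open>qadj A * P2\<close> is a right inverse of \<open>A\<close>, and
    \<open>Q2 * qadj B\<close> a left inverse of \<open>B\<close>.\<close>
  define X0 where "X0 = (qadj A * P2) * C * (Q2 * qadj B)"
  have X0: "X0 \<in> carrier_mat n n" unfolding X0_def by (intro sq A' B' P2 Q2 C)
  have "A * X0 * B = ((A * qadj A) * P2) * C * (Q2 * (qadj B * B))"
    unfolding X0_def using A A' B B' P2(1) Q2(1) C by (simp add: assoc_mult_mat[of _ n n _ n _ n] sq)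
  hence X0eq: "A * X0 * B = C" using P2(2) Q2(2) C by simp

  have rowA: "cA_row A B C i $ k = ddet A *\<^sub>R (P * ctilde A B C) $$ (i, k)" if "i < n" "k < n" for i k
    using that Ct C by (simp add: cA_row_def cdetA index_mult_mat_sum[OF P(1) Ct] del: index_mult_mat(1))
  have colB: "cB_col A B C j $ k = ddet B *\<^sub>R (ctilde A B C * Q) $$ (k, j)" if "j < n" "k < n" for j k
    using that Ct C by (simp add: cB_col_def rdetB index_mult_mat_sum[OF Ct Q(1)] del: index_mult_mat(1))
  \<comment> \<open>The row formula evaluates \<open>W\<close> as
    \<open>(P * ctilde A B C) * Q\<close>, the column formula as
    \<open>P * (ctilde A B C * Q)\<close>.\<close>
  have formulas: "rdet j (replace_row (B * qadj B) (cA_row A B C i) j) = (ddet A * ddet B) *\<^sub>R W $$ (i, j)"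
    "cdet i (replace_col (qadj A * A) (cB_col A B C j) i) = (ddet A * ddet B) *\<^sub>R W $$ (i, j)"
    if ij: "i < n" "j < n" for i j
  proof -
    have PC: "P * ctilde A B C \<in> carrier_mat n n" and CQ: "ctilde A B C * Q \<in> carrier_mat n n"
      by (intro sq P Q Ct)+
    have "cA_row A B C i \<in> carrier_vec n" "cB_col A B C j \<in> carrier_vec n"
      using C by (simp_all add: cA_row_def cB_col_def)
    moreover have "W = P * (ctilde A B C * Q)"
      unfolding W_def using P Q Ct by (intro assoc_mult_mat) auto
    ultimately show "rdet j (replace_row (B * qadj B) (cA_row A B C i) j) = (ddet A * ddet B) *\<^sub>R W $$ (i, j)"
      "cdet i (replace_col (qadj A * A) (cB_col A B C j) i) = (ddet A * ddet B) *\<^sub>R W $$ (i, j)"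
      using ij index_mult_mat_sum[OF PC Q(1) ij] index_mult_mat_sum[OF P(1) CQ ij]
      by (simp_all add: rdetB cdetA rowA colB W_def mult.commute del: index_mult_mat(1)
          flip: scaleR_sum_right)
  qed
  have entries: "X $$ (i, j) = rdet j (replace_row (B * qadj B) (cA_row A B C i) j) / of_real (ddet A * ddet B) \<and>
        X $$ (i, j) = cdet i (replace_col (qadj A * A) (cB_col A B C j) i) / of_real (ddet A * ddet B)"
    if "X \<in> carrier_mat n n" "A * X * B = C" "i < n" "j < n" for X i j
  proof -
    \<comment> \<open>Real quaternions are central, so the scalar may be moved next to the inverse
      that cancels it.\<close>
    have cancel: "(r *\<^sub>R x) / of_real r = x" if "r \<noteq> 0" for r and x :: quat
    proof -
      have "r *\<^sub>R x = x * of_real r" by (simp add: of_real_def)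
      thus ?thesis using that by (simp add: divide_inverse mult.assoc right_inverse)
    qed
    show ?thesis
      using assms(5,6) by (simp add: formulas[OF that(3,4)] solution[OF that(1,2)] cancel del: of_real_mult)
  qed
  have "\<exists>!X. X \<in> carrier_mat n n \<and> A * X * B = C"
  proof (rule ex1I[of _ X0])
    show "X = X0" if "X \<in> carrier_mat n n \<and> A * X * B = C" for X
      using that solution[of X] solution[OF X0 X0eq] by simp
  qed (simp add: X0 X0eq)
  thus ?thesis by (rule conjI) (intro ballI impI allI entries)
qed

end
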